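(* Let $g$ be a $g$-function on a finite alphabet $A$, with context length function $\ell^g$. If there exist $\underline x\in\mathcal{X}^-$ and a subsequential weak limit $\bar\mu^{\underline x}$ of $(\bar\mu^{\underline x,-k})_{k\ge1}$ such that $\bar\mu^{\underline x}(\ell^g<\infty)=1$, then $\bar\mu^{\underline x}\in\mathcal{M}_T(g)$. If moreover the stronger assumption $\mathbb{E}_{\bar\mu^{\underline x}}[\ell^g]<\infty$ holds and $\inf g>0$, then $\mathcal{M}_T(g)$ has a unique element.
   Context: $A$ is a finite (nonempty) alphabet with the discrete topology, $\mathcal{X}=A^{\mathbb{Z}}$, $\mathcal{X}^-=A^{\{\ldots,-2,-1\}}$ (pasts), $\mathcal{X}^{\le 0}=A^{\{\ldots,-1,0\}}$, all with product topologies; $\mathcal{F}^{\le 0}$ and $\mathcal{F}^-$ are the $\sigma$-algebras generated by the coordinates of index $\le 0$ and $\le -1$. For $x\in\mathcal{X}$, $\underline x=\ldots x_{-2}x_{-1}$. $T$ is the shift $(Tx)_n=x_{n+1}$, and $[a]_0=\{x: x_0=a\}$. For a finite string $a_m^n$, $\mu(a_m^n)=\mu(\{x:x_m^n=a_m^n\})$. A $g$-function is an $\mathcal{F}^{\le 0}$-measurable $g:\mathcal{X}^{\le 0}\to[0,1]$ with $\sum_{a\in A}g(\underline x a)=1$ for all $\underline x\in\mathcal{X}^-$, where $\underline x a$ is concatenation. By shifting indices, $g$ is applied to any left-infinite sequence. For a past $\underline x$ followed by a string $a_1\ldots a_n$, $g_n(\underline x a_1\ldots a_n)=\prod_{i=1}^n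 g(\underline x a_1\ldots a_i)$. The context length function is $\ell^g(\underline x)=\inf\{k\ge1: g(\underline y x_{-k}^{-1}a)=g(\underline z x_{-k}^{-1}a)\ \text{for all } a\in A,\ \underline y,\underline z\in\mathcal{X}^-\}$, with $\inf\emptyset=\infty$; it is viewed as a function on $\mathcal{X}$ through $x\mapsto\ell^g(\underline x)$. $\mathcal{M}_T(g)$ is the set of shift-invariant Borel probability measures $\mu$ on $\mathcal{X}$ compatible with $g$, i.e. such that for every $a\in A$, $\mathbb{E}_\mu(\mathbf 1_{[a]_0}\mid\mathcal{F}^-)(x)=g(\underline x a)$ for $\mu$-a.e. $x$. For $\underline x\in\mathcal{X}^-$, $\mu^{\underline x}$ is the unique probability measure on $\mathcal{X}$ with $\mu^{\underline x}(C)=\mathbf 1_C(\underline x)$ for $C\in\mathcal{F}^-$ and $\mu^{\underline x}(a_0^{n-1})=g_n(\underline x a_0^{n-1})$ for all $n\ge1$, $a_0^{n-1}\in A^n$. Put $\mu^{\underline x,-i}=\mu^{\underline x}\circ T^{-i}$ for $i\ge 0$ and $\bar\mu^{\underline x,-k}=\frac1k\sum_{i=0}^{k-1}\mu^{\underline x,-i}$ for $k\ge1$. By compactness this sequence has weakly convergent subsequences; $\bar\mu^{\underline x}$ denotes such a subsequential limit. *)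

theory Defs
  imports "HOL-Probability.Probability"
begin

text \<open>
  A left-infinite sequence, whether indexed by \<open>{..., -2, -1}\<close> or by \<open>{..., -1, 0}\<close>, is a
  function \<open>nat \<Rightarrow> 'a\<close> read from the right end: \<open>w k\<close> is the symbol \<open>k\<close> places to the left of
  the last one. Thus a past \<open>x\<close> has \<open>x\<^bsub>-j\<^esub> = x (j - 1)\<close> for \<open>j \<ge> 1\<close>, and no reindexing is needed
  when a \<open>g\<close>-function is applied to a past extended by several symbols.
  Bi-infinite sequences are functions \<open>int \<Rightarrow> 'a\<close> with the product topology of the function type.
\<close>

definition snoc :: "(nat \<Rightarrow> 'a) \<Rightarrow> 'a \<Rightarrow> nat \<Rightarrow> 'a" where
  "snoc x a = (\<lambda>k. case k of 0 \<Rightarrow> a | Suc j \<Rightarrow> x j)"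

definition append_string :: "(nat \<Rightarrow> 'a) \<Rightarrow> 'a list \<Rightarrow> nat \<Rightarrow> 'a" where
  "append_string x as = foldl snoc x as"

text \<open>The string \<open>x\<^bsub>-k\<^esub> \<dots> x\<^bsub>-1\<^esub>\<close>, in this order.\<close>

definition recent :: "nat \<Rightarrow> (nat \<Rightarrow> 'a) \<Rightarrow> 'a list" where
  "recent k x = rev (map x [0..<k])"

definition past :: "(int \<Rightarrow> 'a) \<Rightarrow> nat \<Rightarrow> 'a" where
  "past x = (\<lambda>k. x (- 1 - int k))"

definition shift :: "(int \<Rightarrow> 'a) \<Rightarrow> int \<Rightarrow> 'a" where
  "shift x = (\<lambda>n. x (n + 1))"

definition cylinder :: "int \<Rightarrow> 'a list \<Rightarrow> (int \<Rightarrow> 'a) set" where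
  "cylinder m as = {x. \<forall>i<length as. x (m + int i) = as ! i}"

definition past_algebra :: "(int \<Rightarrow> 'a) measure" where
  "past_algebra = sigma UNIV {(\<lambda>x. x i) -` B | i B. i \<le> - 1}"

definition g_function :: "((nat \<Rightarrow> 'a::finite) \<Rightarrow> real) \<Rightarrow> bool" where
  "g_function g \<longleftrightarrow>
     g \<in> borel_measurable (Pi\<^sub>M UNIV (\<lambda>_. count_space UNIV)) \<and>
     (\<forall>w. g w \<in> {0..1}) \<and>
     (\<forall>x. (\<Sum>a\<in>UNIV. g (snoc x a)) = 1)"

definition g_string :: "((nat \<Rightarrow> 'a) \<Rightarrow> real) \<Rightarrow> (nat \<Rightarrow> 'a) \<Rightarrow> 'a list \<Rightarrow> real" where
  "g_string g x as = (\<Prod>i=1..length as. g (append_string x (take i as)))"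

definition context_length :: "((nat \<Rightarrow> 'a) \<Rightarrow> real) \<Rightarrow> (nat \<Rightarrow> 'a) \<Rightarrow> enat" where
  "context_length g x =
     (INF k\<in>{k. k \<ge> 1 \<and> (\<forall>a y z. g (append_string y (recent k x @ [a]))
                               = g (append_string z (recent k x @ [a])))}. enat k)"

definition invariant_g_measures ::
  "((nat \<Rightarrow> 'a::{finite,discrete_topology}) \<Rightarrow> real) \<Rightarrow> (int \<Rightarrow> 'a) measure set" where
  "invariant_g_measures g =
     {\<mu>. sets \<mu> = sets borel \<and> prob_space \<mu> \<and> distr \<mu> \<mu> shift = \<mu> \<and>
         (\<forall>a. AE x in \<mu>. real_cond_exp \<mu> past_algebra (indicator {y. y 0 = a}) x
                          = g (snoc (past x) a))}"

text \<open>
  A set \<open>C\<close> in \<open>past_algebra\<close> depends on the past only, so it is identified with the set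
  \<open>past ` C\<close> of pasts. The following conditions determine \<open>\<mu>\<close> uniquely.
\<close>

definition past_measure ::
  "((nat \<Rightarrow> 'a::{finite,discrete_topology}) \<Rightarrow> real) \<Rightarrow> (nat \<Rightarrow> 'a) \<Rightarrow> (int \<Rightarrow> 'a) measure \<Rightarrow> bool" where
  "past_measure g x \<mu> \<longleftrightarrow>
     sets \<mu> = sets borel \<and> prob_space \<mu> \<and>
     (\<forall>C\<in>sets past_algebra. measure \<mu> C = indicator (past ` C) x) \<and>
     (\<forall>as. as \<noteq> [] \<longrightarrow> measure \<mu> (cylinder 0 as) = g_string g x as)"

definition shift_average ::
  "(int \<Rightarrow> 'a::discrete_topology) measure \<Rightarrow> nat \<Rightarrow> (int \<Rightarrow> 'a) measure" where
  "shift_average \<mu> k =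
     measure_of UNIV (sets borel)
       (\<lambda>C. (\<Sum>i<k. emeasure (distr \<mu> borel (shift ^^ i)) C) / of_nat k)"

definition weakly_converges :: "(nat \<Rightarrow> 'b::topological_space measure) \<Rightarrow> 'b measure \<Rightarrow> bool" where
  "weakly_converges M N \<longleftrightarrow>
     (\<forall>f :: 'b \<Rightarrow> real. continuous_on UNIV f \<and> bounded (range f) \<longrightarrow>
        (\<lambda>n. \<integral>x. f x \<partial>M n) \<longlonglongrightarrow> (\<integral>x. f x \<partial>N))"

text \<open>Only the terms of index at least 1 of the sequence \<open>M\<close> are taken into account.\<close>

definition subsequential_weak_limit ::
  "(nat \<Rightarrow> 'b::topological_space measure) \<Rightarrow> 'b measure \<Rightarrow> bool" where
  "subsequential_weak_limit M N \<longleftrightarrow>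
     sets N = sets borel \<and> prob_space N \<and>
     (\<exists>r :: nat \<Rightarrow> nat. strict_mono r \<and> (\<forall>n. r n \<ge> 1) \<and> weakly_converges (\<lambda>n. M (r n)) N)"

lemma continuous_on_shift_power:
  "continuous_on UNIV (shift ^^ i :: (int \<Rightarrow> 'a::topological_space) \<Rightarrow> int \<Rightarrow> 'a)"
proof (induction i)
  case (Suc i)
  have "continuous_on UNIV (shift :: (int \<Rightarrow> 'a) \<Rightarrow> int \<Rightarrow> 'a)"
    unfolding shift_def by (intro continuous_on_coordinatewise_then_product) simp
  then show ?case
    using Suc by (metis continuous_on_compose continuous_on_subset funpow.simps(2) subset_UNIV)
qed (simp add: continuous_on_id id_def)

lemma emeasure_shift_average:
  fixes \<mu> :: "(int \<Rightarrow> 'a::discrete_topology) measure"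
  assumes "sets \<mu> = sets borel" and "C \<in> sets borel"
  shows "emeasure (shift_average \<mu> k) C = (\<Sum>i<k. emeasure \<mu> ((shift ^^ i) -` C)) / of_nat k"
proof -
  have meas: "shift ^^ i \<in> measurable \<mu> borel" for i
    using borel_measurable_continuous_onI[OF continuous_on_shift_power]
      measurable_cong_sets[OF assms(1) refl] by blast
  have sp: "space \<mu> = UNIV"
    using sets_eq_imp_space_eq[OF assms(1)] by simp
  let ?f = "\<lambda>C. (\<Sum>i<k. emeasure (distr \<mu> borel (shift ^^ i)) C) / of_nat k"
  have "emeasure (shift_average \<mu> k) C = ?f C"
    unfolding shift_average_def
  proof (rule emeasure_measure_of_sigma)
    show "sigma_algebra UNIV (sets (borel :: (int \<Rightarrow> 'a) measure))"
      by (metis sets.sigma_algebra_axioms space_borel)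
    show "positive (sets borel) ?f"
      by (simp add: positive_def)
    show "countably_additive (sets borel) ?f"
    proof (rule countably_additiveI)
      fix A :: "nat \<Rightarrow> (int \<Rightarrow> 'a) set"
      assume A: "range A \<subseteq> sets borel" "disjoint_family A"
      have "(\<Sum>n. emeasure (distr \<mu> borel (shift ^^ i)) (A n))
              = emeasure (distr \<mu> borel (shift ^^ i)) (\<Union>n. A n)" for i
        using A by (intro suminf_emeasure) auto
      then show "(\<Sum>n. ?f (A n)) = ?f (\<Union>n. A n)"
        by (simp add: divide_ennreal_def suminf_sum summableI)
    qed
  qed (use assms in auto)
  also have "\<dots> = (\<Sum>i<k. emeasure \<mu> ((shift ^^ i) -` C)) / of_nat k"
    using assms(2) sp by (simp add: emeasure_distr[OF meas])
  finally show ?thesis .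
qed

lemma subalgebra_past_algebra:
  fixes \<mu> :: "(int \<Rightarrow> 'a::discrete_topology) measure"
  assumes "sets \<mu> = sets borel"
  shows "subalgebra \<mu> past_algebra"
proof -
  have "(\<lambda>x. x i) -` B \<in> sets (borel :: (int \<Rightarrow> 'a) measure)" for i :: int and B :: "'a set"
  proof -
    have "open ((\<lambda>x :: int \<Rightarrow> 'a. x i) -` B)"
      by (intro open_vimage Topological_Spaces.open_discrete) simp
    then show ?thesis
      by (rule borel_open)
  qed
  then have "sigma_sets UNIV {(\<lambda>x. x i) -` B | i B. i \<le> - 1} \<subseteq> sets (borel :: (int \<Rightarrow> 'a) measure)"
    using sets.sigma_sets_subset[of _ "borel :: (int \<Rightarrow> 'a) measure"]
    by (smt (verit) mem_Collect_eq space_borel subsetI)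
  then show ?thesis
    using sets_eq_imp_space_eq[OF assms] assms
    by (simp add: subalgebra_def past_algebra_def space_measure_of_conv sets_measure_of_conv)
qed

end

theory Submission
  imports Defs
begin

text \<open>
  Why the limit is compatible. A word \<open>b\<close> is a context if the law of the symbol that
  follows it does not depend on what precedes it. For a context, the relation "the probability of
  \<open>b\<close> followed by \<open>a\<close> is the probability of \<open>b\<close> times
  \<open>g\<close>" holds for all shifts of the starting measure and involves only cylinders,
  whose indicators are continuous. It therefore survives averaging and the weak limit
  (\<open>weak_limit_context\<close>), and the averaging makes the limit shift invariant
  (\<open>weak_limit_stationary\<close>). If the context length is almost surely finite, then
  almost every past ends in a context, and the relations on contexts determine the conditional
  expectation given the past (\<open>cond_exp_eq_next_probability\<close>).

  Why it is unique. If the context length has finite expectation, then the probabilities that a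
  word of length \<open>k\<close> is not a context are summable. By a Borel-Cantelli argument
  (\<open>exists_renewal_word\<close>) there is a word \<open>b\<close> after which, with a
  probability bounded below for all lengths, the whole future is generated without looking back
  beyond the start of \<open>b\<close>; this probability and the law of that future are the same for all
  compatible measures and all pasts. Consider the difference of the cylinder weights of two
  compatible invariant measures. Its total variation on words of length \<open>n\<close> increases
  to a finite limit as \<open>n\<close> grows. If the weights of words \<open>u @ b\<close> had
  both signs, then summing over \<open>u\<close> would cancel a fixed amount of variation at every
  length, because the future after \<open>b\<close> forgets \<open>u\<close>; this contradicts the
  convergence (\<open>renewal_word_fixes_sign\<close>). So one measure dominates the other on the
  words that end in \<open>b\<close>. As \<open>g\<close> is bounded below by a positive number,
  \<open>b\<close> follows every word with a probability bounded below, and the domination spreads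
  to all words (\<open>dominated_by_sign_on_suffix\<close>). Two probability measures of which one
  dominates the other are equal.
\<close>

section \<open>Words and stationary weights\<close>

definition words :: "nat \<Rightarrow> 'a list set" where
  "words n = {w. length w = n}"

lemma finite_words [simp]: "finite (words n :: 'a::finite list set)"
  using finite_lists_length_eq[of "UNIV :: 'a set" n] by (simp add: words_def)

lemma mem_words [simp]: "w \<in> words n \<longleftrightarrow> length w = n"
  by (simp add: words_def)

lemma words_0 [simp]: "words 0 = {[]}"
  by (auto simp: words_def)

lemma sum_words_add:
  fixes f :: "'a::finite list \<Rightarrow> 'b::comm_monoid_add"
  shows "(\<Sum>w\<in>words (m + n). f w) = (\<Sum>u\<in>words m. \<Sum>v\<in>words n. f (u @ v))"
proof -
  have "(\<Sum>u\<in>words m. \<Sum>v\<in>words n. f (u @ v)) = (\<Sum>(u, v)\<in>words m \<times> words n. f (u @ v))"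
    by (simp add: sum.cartesian_product)
  also have "\<dots> = (\<Sum>w\<in>words (m + n). f w)"
    by (rule sum.reindex_bij_witness[where i = "\<lambda>w. (take m w, drop m w)" and j = "\<lambda>(u, v). u @ v"])
      (auto simp: words_def)
  finally show ?thesis ..
qed

lemma sum_words_1:
  fixes f :: "'a::finite list \<Rightarrow> 'b::comm_monoid_add"
  shows "(\<Sum>w\<in>words 1. f w) = (\<Sum>a\<in>UNIV. f [a])"
  by (rule sum.reindex_bij_witness[where i = "\<lambda>a. [a]" and j = hd])
    (auto simp: words_def length_Suc_conv)

text \<open>
  The weights of a shift-invariant probability measure on words: adding a letter on the left or on
  the right splits the weight of a word. The uniqueness argument uses only these weights.
\<close>

definition stationary_weights :: "('a::finite list \<Rightarrow> real) \<Rightarrow> bool" where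
  "stationary_weights p \<longleftrightarrow>
     (\<forall>w. 0 \<le> p w) \<and> p [] = 1 \<and>
     (\<forall>w. (\<Sum>a\<in>UNIV. p (a # w)) = p w) \<and> (\<forall>w. (\<Sum>a\<in>UNIV. p (w @ [a])) = p w)"

lemma sum_left_extensions:
  fixes p :: "'a::finite list \<Rightarrow> 'b::comm_monoid_add"
  assumes "\<And>w. (\<Sum>a\<in>UNIV. p (a # w)) = p w"
  shows "(\<Sum>u\<in>words n. p (u @ w)) = p w"
proof (induction n arbitrary: w)
  case (Suc n)
  have "(\<Sum>u\<in>words (n + 1). p (u @ w)) = (\<Sum>u\<in>words n. \<Sum>a\<in>UNIV. p (u @ a # w))"
    by (simp only: sum_words_add sum_words_1 append_assoc append_Cons append_Nil)
  also have "\<dots> = (\<Sum>a\<in>UNIV. p (a # w))"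
    by (subst sum.swap) (simp add: Suc.IH)
  finally show ?case
    using assms by simp
qed simp

lemma sum_right_extensions:
  fixes p :: "'a::finite list \<Rightarrow> 'b::comm_monoid_add"
  assumes "\<And>w. (\<Sum>a\<in>UNIV. p (w @ [a])) = p w"
  shows "(\<Sum>v\<in>words n. p (w @ v)) = p w"
proof (induction n arbitrary: w)
  case (Suc n)
  have "(\<Sum>v\<in>words (n + 1). p (w @ v)) = (\<Sum>v\<in>words n. \<Sum>a\<in>UNIV. p ((w @ v) @ [a]))"
    by (simp only: sum_words_add sum_words_1 append_assoc)
  also have "\<dots> = p w"
    unfolding assms by (rule Suc.IH)
  finally show ?case
    by simp
qed simp

section \<open>Uniqueness of stationary weights\<close>

lemma nonneg_if_sum_abs_le_sum:
  fixes f :: "'b \<Rightarrow> real"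
  assumes "finite S" and "(\<Sum>i\<in>S. \<bar>f i\<bar>) \<le> (\<Sum>i\<in>S. f i)" and "i \<in> S"
  shows "0 \<le> f i"
proof -
  have "(\<Sum>i\<in>S. \<bar>f i\<bar> - f i) \<le> 0"
    using assms(2) by (simp add: sum_subtractf)
  moreover have "\<bar>f i\<bar> - f i \<le> (\<Sum>i\<in>S. \<bar>f i\<bar> - f i)"
    using assms by (intro member_le_sum) auto
  ultimately show ?thesis
    by linarith
qed

text \<open>
  Think of \<open>d\<close> as the difference of two shift-invariant measures, so that
  \<open>b\<close> is a word after which, along the continuations in \<open>V n\<close>, the
  future does not depend on what precedes \<open>b\<close>. The \<open>n\<close>-letter variation
  \<open>D n\<close> increases to a finite limit, because merging words loses mass only by
  cancellation. If the values \<open>d (u @ b)\<close> cancelled when summed over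
  \<open>u\<close>, then the same fraction would be lost for every continuation \<open>v\<close>
  in \<open>V n\<close>, since \<open>d (u @ b @ v)\<close> is proportional to \<open>d (u @
  b)\<close>. As \<open>V n\<close> keeps mass at least \<open>\<delta>\<close>, the increments of
  \<open>D\<close> would then stay away from 0. Hence nothing cancels.
\<close>

lemma renewal_word_fixes_sign:
  fixes d :: "'a::finite list \<Rightarrow> real" and q :: "'a list \<Rightarrow> real"
  assumes left: "\<And>w. (\<Sum>a\<in>UNIV. d (a # w)) = d w"
    and bound: "\<And>n. (\<Sum>w\<in>words n. \<bar>d w\<bar>) \<le> B"
    and V: "\<And>n. V n \<subseteq> words n"
    and split: "\<And>n u v. v \<in> V n \<Longrightarrow> d (u @ b @ v) = d (u @ b) * q v"
    and q: "\<And>v. 0 \<le> q v" "0 < \<delta>" "\<And>n. \<delta> \<le> (\<Sum>v\<in>V n. q v)"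
  shows "(\<Sum>u\<in>words m. \<bar>d (u @ b)\<bar>) \<le> \<bar>d b\<bar>"
proof -
  define D where "D n = (\<Sum>w\<in>words n. \<bar>d w\<bar>)" for n
  define loss where "loss w = (\<Sum>u\<in>words m. \<bar>d (u @ w)\<bar>) - \<bar>d w\<bar>" for w
  have D_add: "D (k + n) = (\<Sum>w\<in>words n. \<Sum>u\<in>words k. \<bar>d (u @ w)\<bar>)" for k n
    unfolding D_def sum_words_add by (rule sum.swap)
  have le: "\<bar>d w\<bar> \<le> (\<Sum>u\<in>words k. \<bar>d (u @ w)\<bar>)" for w k
    using sum_abs[of "\<lambda>u. d (u @ w)" "words k"] sum_left_extensions[OF left, of w k] by simp
  have loss_nonneg: "0 \<le> loss w" for w
    using le unfolding loss_def by simp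
  have "incseq D"
    by (rule incseq_SucI) (use D_add[of 1] le in \<open>simp add: D_def sum_mono\<close>)
  moreover have "D n \<le> B" for n
    using bound by (simp add: D_def)
  ultimately obtain L where L: "D \<longlonglongrightarrow> L"
    by (metis incseq_convergent)
  (* The increment of the variation is the total cancellation over all words of length
     length b + n; only those that start with b and continue in V n are kept. *)
  have "\<delta> * loss b \<le> D (m + (length b + n)) - D (length b + n)" for n
  proof -
    have "D (m + (length b + n)) - D (length b + n) = (\<Sum>w\<in>words (length b + n). loss w)"
      unfolding D_add[of m] by (simp add: D_def loss_def sum_subtractf)
    also have "\<dots> = (\<Sum>u\<in>words (length b). \<Sum>v\<in>words n. loss (u @ v))"
      by (rule sum_words_add)
    also have "\<dots> \<ge> (\<Sum>v\<in>words n. loss (b @ v))"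
      by (rule member_le_sum) (auto simp: loss_nonneg intro!: sum_nonneg)
    also have "(\<Sum>v\<in>words n. loss (b @ v)) \<ge> (\<Sum>v\<in>V n. loss (b @ v))"
      by (rule sum_mono2) (use V loss_nonneg in auto)
    also have "(\<Sum>v\<in>V n. loss (b @ v)) = (\<Sum>v\<in>V n. loss b * q v)"
    proof (rule sum.cong[OF refl])
      fix v assume v: "v \<in> V n"
      show "loss (b @ v) = loss b * q v"
        using split[OF v] split[OF v, of "[]"] q(1)[of v]
        by (simp add: loss_def abs_mult sum_distrib_right left_diff_distrib)
    qed
    also have "\<dots> \<ge> loss b * \<delta>"
      using q(3)[of n] loss_nonneg[of b] by (simp add: sum_distrib_left[symmetric] mult_left_mono)
    finally show ?thesis
      by (simp add: mult.commute)
  qed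
  moreover have "(\<lambda>n. D (m + (length b + n)) - D (length b + n)) \<longlonglongrightarrow> L - L"
    using LIMSEQ_ignore_initial_segment[OF L, of "m + length b"]
      LIMSEQ_ignore_initial_segment[OF L, of "length b"]
    by (intro tendsto_diff) (simp_all add: add.commute add.left_commute)
  ultimately have "\<delta> * loss b \<le> L - L"
    by (intro LIMSEQ_le_const) auto
  then show ?thesis
    using \<open>0 < \<delta>\<close> by (simp add: loss_def mult_le_0_iff)
qed

text \<open>
  If \<open>p\<^sub>1 \<ge> c * p\<^sub>2\<close>, then the surplus \<open>p\<^sub>1 - c * p\<^sub>2\<close> is additive and
  nonnegative, so at \<open>w\<close> it is at least its value at \<open>w @ b\<close>, which is at least
  \<open>(1 - c) * p\<^sub>2 (w @ b) \<ge> (1 - c) * \<eta> * p\<^sub>2 w\<close>. Thus \<open>c\<close> improves to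
  \<open>c + (1 - c) * \<eta>\<close>, and \<open>1 - c\<close> shrinks by the factor \<open>1 - \<eta>\<close> at each round.
  In the limit \<open>c = 1\<close>.
\<close>

lemma dominated_by_sign_on_suffix:
  fixes p\<^sub>1 p\<^sub>2 :: "'a::finite list \<Rightarrow> real"
  assumes p\<^sub>1: "stationary_weights p\<^sub>1" and p\<^sub>2: "stationary_weights p\<^sub>2"
    and \<eta>: "0 < \<eta>" "\<eta> \<le> 1" "\<And>w. \<eta> * p\<^sub>2 w \<le> p\<^sub>2 (w @ b)"
    and le: "\<And>w. p\<^sub>2 (w @ b) \<le> p\<^sub>1 (w @ b)"
  shows "p\<^sub>2 w \<le> p\<^sub>1 w"
proof -
  have nonneg: "0 \<le> p\<^sub>2 w" "0 \<le> p\<^sub>1 w" for w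
    using p\<^sub>1 p\<^sub>2 by (simp_all add: stationary_weights_def)
  have "(1 - (1 - \<eta>) ^ n) * p\<^sub>2 w \<le> p\<^sub>1 w" for n w
  proof (induction n arbitrary: w)
    case (Suc n)
    define c where "c = 1 - (1 - \<eta>) ^ n"
    define s where "s w = p\<^sub>1 w - c * p\<^sub>2 w" for w
    have c: "c \<le> 1"
      using \<eta> by (simp add: c_def)
    have s_nonneg: "0 \<le> s w" for w
      using Suc.IH by (simp add: s_def c_def)
    have s_right: "(\<Sum>v\<in>words k. s (w @ v)) = s w" for k
      using p\<^sub>1 p\<^sub>2 unfolding s_def stationary_weights_def
      by (simp add: sum_subtractf sum_distrib_left[symmetric] sum_right_extensions)
    have "(1 - c) * (\<eta> * p\<^sub>2 w) \<le> (1 - c) * p\<^sub>2 (w @ b)"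
      using \<eta> c by (intro mult_left_mono) auto
    also have "\<dots> \<le> s (w @ b)"
      using le by (simp add: s_def algebra_simps)
    also have "\<dots> \<le> (\<Sum>v\<in>words (length b). s (w @ v))"
      by (rule member_le_sum) (use s_nonneg in auto)
    also have "\<dots> = p\<^sub>1 w - c * p\<^sub>2 w"
      unfolding s_right by (simp add: s_def)
    finally show ?case
      by (simp add: c_def algebra_simps)
  qed (simp add: nonneg)
  moreover have "(\<lambda>n. (1 - (1 - \<eta>) ^ n) * p\<^sub>2 w) \<longlonglongrightarrow> (1 - 0) * p\<^sub>2 w"
    using \<eta> by (intro tendsto_intros LIMSEQ_realpow_zero) auto
  ultimately show ?thesis
    by (intro LIMSEQ_le_const2[where X = "\<lambda>n. (1 - (1 - \<eta>) ^ n) * p\<^sub>2 w"]) auto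
qed

lemma stationary_weights_eqI:
  fixes p\<^sub>1 p\<^sub>2 :: "'a::finite list \<Rightarrow> real"
  assumes p\<^sub>1: "stationary_weights p\<^sub>1" and p\<^sub>2: "stationary_weights p\<^sub>2"
    and le: "\<And>w. p\<^sub>2 w \<le> p\<^sub>1 w"
  shows "p\<^sub>1 = p\<^sub>2"
proof
  fix w :: "'a list"
  have total: "(\<Sum>v\<in>words (length w). p v) = 1" if "stationary_weights p" for p :: "'a list \<Rightarrow> real"
    using sum_right_extensions[of p, where n = "length w" and w = "[]"] that by (simp add: stationary_weights_def)
  have "p\<^sub>1 w - p\<^sub>2 w \<le> (\<Sum>v\<in>words (length w). p\<^sub>1 v - p\<^sub>2 v)"
    by (rule member_le_sum) (use le in auto)
  also have "\<dots> = 0"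
    using total p\<^sub>1 p\<^sub>2 by (simp add: sum_subtractf)
  finally show "p\<^sub>1 w = p\<^sub>2 w"
    using le[of w] by simp
qed

text \<open>
  The difference \<open>d\<close> of the weights has a constant sign on the words that end in
  \<open>b\<close>, by \<open>renewal_word_fixes_sign\<close>. As \<open>b\<close> has conditional
  probability at least \<open>\<epsilon> ^ length b\<close> after every word, one weight dominates
  the other everywhere, and equal total masses force equality.
\<close>

lemma stationary_weights_unique:
  fixes p\<^sub>1 p\<^sub>2 :: "'a::finite list \<Rightarrow> real" and q :: "'a list \<Rightarrow> real"
  assumes p\<^sub>1: "stationary_weights p\<^sub>1" and p\<^sub>2: "stationary_weights p\<^sub>2"
    and \<epsilon>: "0 < \<epsilon>" "\<epsilon> \<le> 1" "\<And>w a. \<epsilon> * p\<^sub>1 w \<le> p\<^sub>1 (w @ [a])" "\<And>w a. \<epsilon> * p\<^sub>2 w \<le> p\<^sub>2 (w @ [a])"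
    and V: "\<And>n. V n \<subseteq> words n"
    and split: "\<And>n u v. v \<in> V n \<Longrightarrow> p\<^sub>1 (u @ b @ v) = p\<^sub>1 (u @ b) * q v"
      "\<And>n u v. v \<in> V n \<Longrightarrow> p\<^sub>2 (u @ b @ v) = p\<^sub>2 (u @ b) * q v"
    and q: "\<And>v. 0 \<le> q v" "0 < \<delta>" "\<And>n. \<delta> \<le> (\<Sum>v\<in>V n. q v)"
  shows "p\<^sub>1 = p\<^sub>2"
proof -
  have insert_b: "\<epsilon> ^ length b * p w \<le> p (w @ b)" if "\<And>w a. \<epsilon> * p w \<le> p (w @ [a])" for p w
  proof (induction b rule: rev_induct)
    case (snoc a b)
    have "\<epsilon> ^ Suc (length b) * p w \<le> \<epsilon> * p (w @ b)"
      using snoc \<open>0 < \<epsilon>\<close> by (simp add: mult.assoc)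
    also have "\<dots> \<le> p ((w @ b) @ [a])"
      by (rule that)
    finally show ?case
      by simp
  qed simp
  define d where "d w = p\<^sub>1 w - p\<^sub>2 w" for w
  have total: "(\<Sum>v\<in>words n. p v) = 1" if "stationary_weights p" for n and p :: "'a list \<Rightarrow> real"
    using sum_right_extensions[of p, where n = n and w = "[]"] that by (simp add: stationary_weights_def)
  have left: "(\<Sum>a\<in>UNIV. d (a # w)) = d w" for w
    using p\<^sub>1 p\<^sub>2 unfolding d_def stationary_weights_def by (simp only: sum_subtractf)
  have loss: "(\<Sum>u\<in>words m. \<bar>d (u @ b)\<bar>) \<le> \<bar>d b\<bar>" for m
  proof (rule renewal_word_fixes_sign[OF left _ V _ q])
    fix n
    have "(\<Sum>w\<in>words n. \<bar>d w\<bar>) \<le> (\<Sum>w\<in>words n. p\<^sub>1 w + p\<^sub>2 w)"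
      using p\<^sub>1 p\<^sub>2 by (intro sum_mono) (simp add: d_def stationary_weights_def abs_le_iff)
    then show "(\<Sum>w\<in>words n. \<bar>d w\<bar>) \<le> 2"
      using total[OF p\<^sub>1, of n] total[OF p\<^sub>2, of n] by (simp add: sum.distrib)
  next
    show "d (u @ b @ v) = d (u @ b) * q v" if "v \<in> V n" for n u v
      using split that by (simp add: d_def left_diff_distrib)
  qed
  have \<eta>: "0 < \<epsilon> ^ length b" "\<epsilon> ^ length b \<le> 1"
    using \<epsilon> by (simp_all add: power_le_one)
  have sum_d: "(\<Sum>u\<in>words m. d (u @ b)) = d b" for m
    by (rule sum_left_extensions[OF left])
  show ?thesis
  proof (cases "0 \<le> d b")
    case True
    have "0 \<le> d (u @ b)" for u
      by (rule nonneg_if_sum_abs_le_sum[of "words (length u)" "\<lambda>u. d (u @ b)"])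
        (use loss[of "length u"] True in \<open>simp_all add: sum_d\<close>)
    then have "p\<^sub>2 (u @ b) \<le> p\<^sub>1 (u @ b)" for u
      by (simp add: d_def)
    then have "p\<^sub>2 w \<le> p\<^sub>1 w" for w
      by (rule dominated_by_sign_on_suffix[OF p\<^sub>1 p\<^sub>2 \<eta> insert_b[of p\<^sub>2, OF \<epsilon>(4)]])
    then show ?thesis
      by (rule stationary_weights_eqI[OF p\<^sub>1 p\<^sub>2])
  next
    case False
    have "0 \<le> - d (u @ b)" for u
    proof (rule nonneg_if_sum_abs_le_sum[of "words (length u)" "\<lambda>u. - d (u @ b)"])
      show "(\<Sum>i\<in>words (length u). \<bar>- d (i @ b)\<bar>) \<le> (\<Sum>i\<in>words (length u). - d (i @ b))"
        using loss[of "length u"] False unfolding sum_negf sum_d abs_minus_cancel by linarith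
    qed simp_all
    then have "p\<^sub>1 (u @ b) \<le> p\<^sub>2 (u @ b)" for u
      by (simp add: d_def)
    then have "p\<^sub>1 w \<le> p\<^sub>2 w" for w
      by (rule dominated_by_sign_on_suffix[OF p\<^sub>2 p\<^sub>1 \<eta> insert_b[of p\<^sub>1, OF \<epsilon>(3)]])
    then show ?thesis
      by (rule stationary_weights_eqI[OF p\<^sub>2 p\<^sub>1, symmetric])
  qed
qed

section \<open>Cylinders\<close>

lemma finite_words_such_that [simp]: "finite {w :: 'a::finite list. length w = n \<and> P w}"
  by (rule finite_subset[OF _ finite_words[of n]]) auto

lemma cylinder_Nil [simp]: "cylinder m [] = UNIV"
  by (simp add: cylinder_def)

lemma cylinder_append:
  "cylinder m (u @ v) = cylinder m u \<inter> cylinder (m + int (length u)) v"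
proof (intro set_eqI iffI)
  fix x :: "int \<Rightarrow> 'a"
  assume x: "x \<in> cylinder m (u @ v)"
  have "x (m + int i) = u ! i" if "i < length u" for i
    using x that unfolding cylinder_def by (auto dest!: spec[of _ i] simp: nth_append)
  moreover have "x (m + int (length u) + int i) = v ! i" if "i < length v" for i
    using x that unfolding cylinder_def by (auto dest!: spec[of _ "length u + i"] simp: nth_append add.assoc)
  ultimately show "x \<in> cylinder m u \<inter> cylinder (m + int (length u)) v"
    by (simp add: cylinder_def)
next
  fix x :: "int \<Rightarrow> 'a"
  assume x: "x \<in> cylinder m u \<inter> cylinder (m + int (length u)) v"
  have "x (m + int i) = (u @ v) ! i" if "i < length (u @ v)" for i
  proof (cases "i < length u")
    case False
    then have "i - length u < length v"
      using that by auto
    moreover have "\<forall>j<length v. x (m + int (length u) + int j) = v ! j"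
      using x by (simp add: cylinder_def)
    ultimately have "x (m + int (length u) + int (i - length u)) = v ! (i - length u)"
      by blast
    moreover have "m + int (length u) + int (i - length u) = m + int i"
      using False by simp
    ultimately have "x (m + int i) = v ! (i - length u)"
      by metis
    then show ?thesis
      using False by (simp add: nth_append)
  qed (use x in \<open>simp add: cylinder_def nth_append\<close>)
  then show "x \<in> cylinder m (u @ v)"
    by (simp add: cylinder_def)
qed

lemma cylinder_single: "cylinder m [a] = {x. x m = a}"
  by (simp add: cylinder_def)

lemma cylinder_snoc: "cylinder m (w @ [a]) = cylinder m w \<inter> {x. x (m + int (length w)) = a}"
  by (simp add: cylinder_append cylinder_single)

lemma cylinder_Cons: "cylinder m (a # w) = {x. x m = a} \<inter> cylinder (m + 1) w"
  using cylinder_append[of m "[a]" w] by (simp add: cylinder_single)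

lemma disjoint_cylinders:
  assumes "length v = length w" and "v \<noteq> w"
  shows "cylinder m v \<inter> cylinder m w = {}"
  using assms by (auto simp: cylinder_def list_eq_iff_nth_eq)

lemma cylinder_inter:
  assumes "m' \<le> m" and "m + int (length w) \<le> m' + int (length w')"
  shows "cylinder m w \<inter> cylinder m' w' = {} \<or> cylinder m w \<inter> cylinder m' w' = cylinder m' w'"
proof (cases "cylinder m w \<inter> cylinder m' w' = {}")
  case False
  then obtain x where x: "x \<in> cylinder m w" "x \<in> cylinder m' w'"
    by blast
  have "y \<in> cylinder m w" if y: "y \<in> cylinder m' w'" for y
    unfolding cylinder_def
  proof (intro CollectI allI impI)
    fix i
    assume i: "i < length w"
    define j where "j = nat (m - m') + i"
    have "m + int i = m' + int j" "j < length w'"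
      using assms i by (auto simp: j_def)
    then have "y (m + int i) = x (m + int i)"
      using x(2) y by (simp add: cylinder_def)
    then show "y (m + int i) = w ! i"
      using x(1) i by (simp add: cylinder_def)
  qed
  then show ?thesis
    by blast
qed simp

lemma clopen_cylinder:
  fixes w :: "'a::discrete_topology list"
  shows "open (cylinder m w)" and "closed (cylinder m w)"
proof -
  have eq: "cylinder m w = (\<Inter>i<length w. (\<lambda>x. x (m + int i)) -` {w ! i})"
    by (auto simp: cylinder_def)
  show "open (cylinder m w)"
    unfolding eq by (intro open_INT ballI open_vimage Topological_Spaces.open_discrete) simp_all
  show "closed (cylinder m w)"
    unfolding eq by (intro closed_INT ballI closed_vimage closed_singleton) simp_all
qed

lemma cylinder_borel [measurable, simp]:
  "cylinder m (w :: 'a::discrete_topology list) \<in> sets borel"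
  by (rule borel_open) (rule clopen_cylinder)

lemma continuous_on_indicator_cylinder:
  "continuous_on UNIV (indicator (cylinder m (w :: 'a::discrete_topology list)) :: _ \<Rightarrow> real)"
proof -
  have "continuous_on (cylinder m w \<union> - cylinder m w) (\<lambda>x. if x \<in> cylinder m w then 1 else 0 :: real)"
    using clopen_cylinder[of m w] by (intro continuous_on_cases) auto
  then show ?thesis
    by (simp add: indicator_def[abs_def] of_bool_def)
qed

text \<open>
  Events that depend on finitely many coordinates are written as conditions on a window; they
  split into cylinders by \<open>window_event_eq\<close>.
\<close>

definition window :: "int \<Rightarrow> nat \<Rightarrow> (int \<Rightarrow> 'a) \<Rightarrow> 'a list" where
  "window m n x = map (\<lambda>i. x (m + int i)) [0..<n]"

lemma length_window [simp]: "length (window m n x) = n"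
  by (simp add: window_def)

lemma window_eq_iff: "window m n x = w \<longleftrightarrow> length w = n \<and> x \<in> cylinder m w"
  by (auto simp: window_def cylinder_def list_eq_iff_nth_eq)

lemma mem_cylinder_window [simp]: "x \<in> cylinder m (window m n x)"
  by (simp add: cylinder_def window_def)

lemma window_event_eq: "{x. P (window m n x)} = (\<Union>w\<in>{w\<in>words n. P w}. cylinder m w)"
proof (intro set_eqI iffI)
  fix x assume "x \<in> {x. P (window m n x)}"
  then show "x \<in> (\<Union>w\<in>{w\<in>words n. P w}. cylinder m w)"
    by (intro UN_I[of "window m n x"]) auto
qed (auto simp: window_eq_iff[THEN iffD2])

lemma window_event_borel [measurable, simp]:
  "{x :: int \<Rightarrow> 'a::{finite,discrete_topology}. P (window m n x)} \<in> sets borel"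
  unfolding window_event_eq by (intro sets.finite_UN) auto

lemma disjoint_family_cylinders:
  assumes "S \<subseteq> words n"
  shows "disjoint_family_on (cylinder m) S"
  unfolding disjoint_family_on_def
proof (intro ballI impI)
  fix v w
  assume "v \<in> S" "w \<in> S" "v \<noteq> w"
  then show "cylinder m v \<inter> cylinder m w = {}"
    using subsetD[OF assms, of v] subsetD[OF assms, of w] by (intro disjoint_cylinders) auto
qed

lemma measure_window_event:
  fixes M :: "(int \<Rightarrow> 'a::{finite,discrete_topology}) measure"
  assumes "sets M = sets borel" and "finite_measure M"
  shows "measure M {x. P (window m n x)} = (\<Sum>w | w \<in> words n \<and> P w. measure M (cylinder m w))"
proof -
  interpret finite_measure M by fact
  show ?thesis
    unfolding window_event_eq
    by (intro finite_measure_finite_Union disjoint_family_cylinders[of _ n]) (auto simp: assms(1))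
qed

lemma sum_measure_cylinder_snoc:
  fixes M :: "(int \<Rightarrow> 'a::{finite,discrete_topology}) measure"
  assumes "sets M = sets borel" and "finite_measure M"
  shows "(\<Sum>a\<in>UNIV. measure M (cylinder m (w @ [a]))) = measure M (cylinder m w)"
proof -
  interpret finite_measure M by fact
  have "cylinder m w = (\<Union>a\<in>UNIV. cylinder m (w @ [a]))"
    by (auto simp: cylinder_snoc)
  moreover have "measure M (\<Union>a\<in>UNIV. cylinder m (w @ [a])) = (\<Sum>a\<in>UNIV. measure M (cylinder m (w @ [a])))"
    by (intro finite_measure_finite_Union) (auto simp: assms(1) disjoint_family_on_def cylinder_snoc)
  ultimately show ?thesis
    by simp
qed

lemma sum_measure_cylinder_Cons:
  fixes M :: "(int \<Rightarrow> 'a::{finite,discrete_topology}) measure"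
  assumes "sets M = sets borel" and "finite_measure M"
  shows "(\<Sum>a\<in>UNIV. measure M (cylinder m (a # w))) = measure M (cylinder (m + 1) w)"
proof -
  interpret finite_measure M by fact
  have "cylinder (m + 1) w = (\<Union>a\<in>UNIV. cylinder m (a # w))"
    by (auto simp: cylinder_Cons)
  moreover have "measure M (\<Union>a\<in>UNIV. cylinder m (a # w)) = (\<Sum>a\<in>UNIV. measure M (cylinder m (a # w)))"
    by (intro finite_measure_finite_Union) (auto simp: assms(1) disjoint_family_on_def cylinder_Cons)
  ultimately show ?thesis
    by simp
qed

text \<open>
  Cylinders over the windows \<open>[-n, n)\<close> are nested or disjoint, unlike cylinders over
  arbitrary intervals, whose intersections need not be cylinders. So they form, with the empty
  set, a generator of the Borel sets that is stable under intersection.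
\<close>

definition symmetric_cylinders :: "(int \<Rightarrow> 'a) set set" where
  "symmetric_cylinders = {cylinder (- int n) w | n w. length w = 2 * n}"

lemma topological_basis_symmetric_cylinders:
  "topological_basis (symmetric_cylinders :: (int \<Rightarrow> 'a::discrete_topology) set set)"
proof (rule topological_basisI)
  show "open B" if "B \<in> symmetric_cylinders" for B :: "(int \<Rightarrow> 'a) set"
    using that clopen_cylinder by (auto simp: symmetric_cylinders_def)
next
  fix U :: "(int \<Rightarrow> 'a) set" and x
  assume "open U" and "x \<in> U"
  then obtain X where X: "x \<in> Pi\<^sub>E UNIV X" "finite {i. X i \<noteq> UNIV}" "Pi\<^sub>E UNIV X \<subseteq> U"
    using product_topology_open_contains_basis[of "\<lambda>_. euclidean" UNIV U x]
    by (auto simp: open_fun_def)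
  obtain n where n: "\<And>i. X i \<noteq> UNIV \<Longrightarrow> nat \<bar>i\<bar> < n"
    using X(2) finite_nat_set_iff_bounded[of "(\<lambda>i. nat \<bar>i\<bar>) ` {i. X i \<noteq> UNIV}"] by auto
  have "cylinder (- int n) (window (- int n) (2 * n) x) \<subseteq> Pi\<^sub>E UNIV X"
  proof
    fix y
    assume "y \<in> cylinder (- int n) (window (- int n) (2 * n) x)"
    then have y: "y (- int n + int i) = x (- int n + int i)" if "i < 2 * n" for i
      using that by (simp add: cylinder_def window_def)
    have "y i \<in> X i" for i
    proof (cases "X i = UNIV")
      case False
      then have "nat \<bar>i\<bar> < n"
        by (rule n)
      then have "int (nat (i + int n)) = i + int n" "nat (i + int n) < 2 * n"
        by linarith+
      then have "y i = x i"
        using y[of "nat (i + int n)"] by simp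
      then show ?thesis
        using X(1) by auto
    qed simp
    then show "y \<in> Pi\<^sub>E UNIV X"
      by auto
  qed
  moreover have "cylinder (- int n) (window (- int n) (2 * n) x) \<in> symmetric_cylinders"
    unfolding symmetric_cylinders_def by (intro CollectI exI conjI, rule refl) simp
  ultimately show "\<exists>B\<in>symmetric_cylinders. x \<in> B \<and> B \<subseteq> U"
    using X(3) mem_cylinder_window by (meson subset_trans)
qed

lemma countable_symmetric_cylinders:
  "countable (symmetric_cylinders :: (int \<Rightarrow> 'a::finite) set set)"
proof -
  have "symmetric_cylinders = (\<Union>n. cylinder (- int n) ` (words (2 * n) :: 'a list set))"
    by (fastforce simp: symmetric_cylinders_def)
  moreover have "countable (\<Union>n. cylinder (- int n) ` (words (2 * n) :: 'a list set))"
    by (intro countable_UN) (auto intro: countable_finite)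
  ultimately show ?thesis
    by metis
qed

lemma measure_eqI_cylinders:
  fixes M N :: "(int \<Rightarrow> 'a::{finite,discrete_topology}) measure"
  assumes M: "sets M = sets borel" "finite_measure M" and N: "sets N = sets borel" "finite_measure N"
    and eq: "\<And>m w. measure M (cylinder m w) = measure N (cylinder m w)"
  shows "M = N"
proof -
  interpret M: finite_measure M by fact
  interpret N: finite_measure N by fact
  let ?E = "insert {} symmetric_cylinders :: (int \<Rightarrow> 'a) set set"
  have borel: "sets borel = sigma_sets UNIV ?E"
  proof -
    have "borel = sigma UNIV ?E"
      by (intro borel_eq_countable_basis topological_basisI)
        (auto simp: countable_symmetric_cylinders topological_basis_open[OF topological_basis_symmetric_cylinders]
          elim!: topological_basisE[OF topological_basis_symmetric_cylinders])
    then have "sets borel = sets (sigma UNIV ?E)"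
      by (rule arg_cong)
    also have "\<dots> = sigma_sets UNIV ?E"
      by (rule sets_measure_of) simp
    finally show ?thesis .
  qed
  show ?thesis
  proof (rule measure_eqI_generator_eq_countable[of ?E UNIV M N ?E])
    show "Int_stable ?E"
    proof (rule Int_stableI)
      fix B C :: "(int \<Rightarrow> 'a) set"
      assume BC: "B \<in> ?E" "C \<in> ?E"
      have *: "cylinder (- int n) w \<inter> cylinder (- int n') w' \<in> ?E"
        if "length w = 2 * n" "length w' = 2 * n'" "n \<le> n'" for n n' and w w' :: "'a list"
        using cylinder_inter[of "- int n'" "- int n" w w'] that by (auto simp: symmetric_cylinders_def)
      show "B \<inter> C \<in> ?E"
      proof (cases "B = {} \<or> C = {}")
        case False
        then obtain n w n' w' where "B = cylinder (- int n) w" "length w = 2 * n"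
          "C = cylinder (- int n') w'" "length w' = 2 * n'"
          using BC by (auto simp: symmetric_cylinders_def)
        then show ?thesis
          using *[of w n w' n'] *[of w' n' w n] by (cases n n' rule: le_cases) (auto simp: Int_commute)
      qed auto
    qed
    show "emeasure M X = emeasure N X" if "X \<in> ?E" for X
      using that by (auto simp: symmetric_cylinders_def M.emeasure_eq_measure N.emeasure_eq_measure eq)
    have "UNIV \<in> symmetric_cylinders"
      by (auto simp: symmetric_cylinders_def intro!: exI[of _ 0])
    then show "\<Union>?E = UNIV"
      by blast
  qed (use M N borel countable_symmetric_cylinders in auto)
qed

lemma past_algebra_eq_sigma_cylinders:
  "sets (past_algebra :: (int \<Rightarrow> 'a::finite) measure) =
     sigma_sets UNIV (insert {} {cylinder (- int n) w | n w. length w = n})"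
    (is "_ = sigma_sets UNIV ?E")
proof -
  let ?G = "{(\<lambda>x. x i) -` B | i B. i \<le> - 1} :: (int \<Rightarrow> 'a) set set"
  have "sets (past_algebra :: (int \<Rightarrow> 'a) measure) = sigma_sets UNIV ?G"
    by (simp add: past_algebra_def sets_measure_of_conv)
  also have "\<dots> = sigma_sets UNIV ?E"
  proof (rule sigma_sets_eqI)
    fix C :: "(int \<Rightarrow> 'a) set"
    assume "C \<in> ?G"
    then obtain i B where C: "C = (\<lambda>x. x i) -` B" and i: "i \<le> - 1"
      by blast
    define n where "n = nat (- i)"
    have "C = {x. window (- int n) n x ! 0 \<in> B}"
      using i by (auto simp: C n_def window_def)
    also have "\<dots> = (\<Union>w\<in>{w\<in>words n. w ! 0 \<in> B}. cylinder (- int n) w)"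
      by (rule window_event_eq)
    also have "\<dots> \<in> sets (sigma UNIV ?E)"
      by (intro sets.finite_UN) (auto intro!: sigma_sets.Basic)
    finally show "C \<in> sigma_sets UNIV ?E"
      by simp
  next
    fix C :: "(int \<Rightarrow> 'a) set"
    assume "C \<in> ?E"
    then consider "C = {}" | n w where "C = cylinder (- int n) w" "length w = n"
      by blast
    then show "C \<in> sigma_sets UNIV ?G"
    proof cases
      case 2
      have "(\<lambda>x. x (- int n + int i)) -` {w ! i} \<in> ?G" if "i < n" for i
        using that by (intro CollectI exI conjI) (rule refl, linarith)
      then have G: "(\<lambda>x. x (- int n + int i)) -` {w ! i} \<in> sets (sigma UNIV ?G)" if "i < n" for i
        using that by (simp add: sigma_sets.Basic)
      have "C = UNIV \<inter> (\<Inter>i\<in>{..<n}. (\<lambda>x. x (- int n + int i)) -` {w ! i})"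
        using 2 by (auto simp: cylinder_def)
      also have "\<dots> \<in> sets (sigma UNIV ?G)"
      proof (cases "n = 0")
        case False
        then show ?thesis
          using G by (intro sets.Int sets.finite_INT) (auto intro: sigma_sets_top)
      qed (auto intro: sigma_sets_top)
      finally show ?thesis
        by simp
    qed (simp add: sigma_sets.Empty)
  qed
  finally show ?thesis .
qed

lemma Int_stable_past_cylinders:
  "Int_stable (insert {} {cylinder (- int n) w | n w. length w = n} :: (int \<Rightarrow> 'a) set set)"
    (is "Int_stable ?E")
proof (rule Int_stableI)
  fix B C :: "(int \<Rightarrow> 'a) set"
  assume BC: "B \<in> ?E" "C \<in> ?E"
  have *: "cylinder (- int (length w)) w \<inter> cylinder (- int (length w')) w' \<in> ?E"
    if "length w \<le> length w'" for w w' :: "'a list"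
    using cylinder_inter[of "- int (length w')" "- int (length w)" w w'] that by auto
  show "B \<inter> C \<in> ?E"
  proof (cases "B = {} \<or> C = {}")
    case False
    then obtain w w' where "B = cylinder (- int (length w)) w" "C = cylinder (- int (length w')) w'"
      using BC by auto
    then show ?thesis
      using *[of w w'] *[of w' w] by (cases "length w" "length w'" rule: le_cases) (auto simp: Int_commute)
  qed auto
qed

section \<open>Stationarity\<close>

lemma shift_power: "(shift ^^ i) x n = x (n + int i)"
  by (induction i arbitrary: n) (simp_all add: shift_def algebra_simps)

lemma shift_power_vimage_cylinder: "(shift ^^ i) -` cylinder m w = cylinder (m + int i) w"
  by (auto simp: cylinder_def shift_power add.commute add.left_commute)

lemma shift_vimage_cylinder: "shift -` cylinder m w = cylinder (m + 1) w"
  using shift_power_vimage_cylinder[of 1 m w] by simp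

lemma measurable_shift [measurable]:
  "shift \<in> borel_measurable (borel :: (int \<Rightarrow> 'a::topological_space) measure)"
  using borel_measurable_continuous_onI[OF continuous_on_shift_power[of 1]] by simp

lemma measure_distr_shift_cylinder:
  fixes M :: "(int \<Rightarrow> 'a::discrete_topology) measure"
  assumes "sets M = sets borel"
  shows "measure (distr M M shift) (cylinder m w) = measure M (cylinder (m + 1) w)"
proof -
  have "shift \<in> measurable M M"
    using measurable_shift by (simp add: measurable_cong_sets[OF assms assms])
  moreover have "space M = UNIV"
    using sets_eq_imp_space_eq[OF assms] by simp
  ultimately show ?thesis
    by (simp add: measure_distr assms shift_vimage_cylinder)
qed

lemma stationary_cylinder:
  fixes M :: "(int \<Rightarrow> 'a::discrete_topology) measure"
  assumes "\<And>m. measure M (cylinder (m + 1) w) = measure M (cylinder m w)"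
  shows "measure M (cylinder m w) = measure M (cylinder 0 w)"
proof (induction m rule: int_induct[of _ 0])
  case (step2 i)
  then show ?case
    using assms[of "i - 1"] by simp
qed (simp_all add: assms)

lemma stationary_weights_measure_cylinder:
  fixes M :: "(int \<Rightarrow> 'a::{finite,discrete_topology}) measure"
  assumes "sets M = sets borel" and "prob_space M"
    and "\<And>m w. measure M (cylinder m w) = measure M (cylinder 0 w)"
  shows "stationary_weights (\<lambda>w. measure M (cylinder 0 w))"
proof -
  interpret prob_space M by fact
  have "space M = UNIV"
    using sets_eq_imp_space_eq[OF assms(1)] by simp
  then show ?thesis
    unfolding stationary_weights_def
    using prob_space assms(3)[of 1] finite_measure_axioms
    by (simp add: sum_measure_cylinder_snoc[OF assms(1)] sum_measure_cylinder_Cons[OF assms(1)])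
qed

section \<open>Contexts\<close>

lemma append_string_append: "append_string x (u @ v) = append_string (append_string x u) v"
  by (simp add: append_string_def)

lemma append_string_snoc: "append_string x (w @ [a]) = snoc (append_string x w) a"
  by (simp add: append_string_def)

lemma g_string_snoc: "g_string g x (w @ [a]) = g_string g x w * g (append_string x (w @ [a]))"
proof -
  have "(\<Prod>i=1..length w. g (append_string x (take i (w @ [a])))) =
      (\<Prod>i=1..length w. g (append_string x (take i w)))"
    by (rule prod.cong) simp_all
  then show ?thesis
    by (simp add: g_string_def)
qed

lemma g_string_nonneg: "g_function g \<Longrightarrow> 0 \<le> g_string g x w"
  unfolding g_string_def g_function_def by (intro prod_nonneg) auto

text \<open>
  A past is its \<open>k\<close> last symbols appended to the rest; this makes \<open>g\<close> at
  a past comparable with \<open>g\<close> at a string appended to an arbitrary past.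
\<close>

lemma append_string_recent: "append_string (\<lambda>j. y (j + k)) (recent k y) = y"
proof (induction k)
  case (Suc k)
  have "append_string (\<lambda>j. y (j + Suc k)) (recent (Suc k) y) =
      append_string (snoc (\<lambda>j. y (j + Suc k)) (y k)) (recent k y)"
    by (simp add: recent_def append_string_def)
  also have "snoc (\<lambda>j. y (j + Suc k)) (y k) = (\<lambda>j. y (j + k))"
    by (auto simp: snoc_def fun_eq_iff split: nat.split)
  finally show ?case
    using Suc.IH by simp
qed (simp add: recent_def append_string_def)

lemma recent_past: "recent k (past x) = window (- int k) k x"
proof (rule nth_equalityI)
  fix i
  assume "i < length (recent k (past x))"
  then have i: "i < k"
    by (simp add: recent_def)
  then have "- 1 - int (k - Suc i) = - int k + int i"
    by simp
  then show "recent k (past x) ! i = window (- int k) k x ! i"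
    using i by (simp add: recent_def window_def past_def rev_nth)
qed (simp add: recent_def)

text \<open>
  The condition in the definition of the context length, but for a word and without the
  restriction to positive lengths. It is inherited by longer words with the same end, so the
  length \<open>k\<close> can always be increased.
\<close>

definition is_context :: "((nat \<Rightarrow> 'a) \<Rightarrow> real) \<Rightarrow> 'a list \<Rightarrow> bool" where
  "is_context g w \<longleftrightarrow> (\<forall>a y z. g (append_string y (w @ [a])) = g (append_string z (w @ [a])))"

lemma is_context_append: "is_context g v \<Longrightarrow> is_context g (u @ v)"
  unfolding is_context_def append_assoc append_string_append[of _ u] by blast

lemma is_contextD:
  "is_context g v \<Longrightarrow> g (append_string y (u @ v @ [a])) = g (append_string z (v @ [a]))"
  unfolding is_context_def append_string_append[of _ u] by blast

lemma recent_add: "recent (k + n) y = recent n (\<lambda>j. y (j + k)) @ recent k y"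
  unfolding recent_def by (rule nth_equalityI) (auto simp: nth_append rev_nth add.commute)

lemma is_context_recent_mono:
  assumes "is_context g (recent k y)" and "k \<le> n"
  shows "is_context g (recent n y)"
proof -
  obtain j where "n = k + j"
    using assms(2) le_Suc_ex by blast
  then show ?thesis
    using assms(1) by (simp add: recent_add is_context_append)
qed

lemma g_at_context:
  assumes "is_context g (recent k y)"
  shows "g (snoc y a) = g (append_string z (recent k y @ [a]))"
proof -
  have "g (snoc y a) = g (append_string (\<lambda>j. y (j + k)) (recent k y @ [a]))"
    by (simp add: append_string_snoc append_string_recent)
  then show ?thesis
    using assms unfolding is_context_def by simp
qed

lemma context_length_finite_iff: "context_length g y < \<infinity> \<longleftrightarrow> (\<exists>k. is_context g (recent k y))"
proof
  assume "context_length g y < \<infinity>"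
  then show "\<exists>k. is_context g (recent k y)"
    unfolding context_length_def INF_less_iff is_context_def by auto
next
  assume "\<exists>k. is_context g (recent k y)"
  then obtain k where "is_context g (recent (Suc k) y)"
    using is_context_recent_mono[of g _ y] by (meson le_SucI order_refl)
  then have "context_length g y \<le> enat (Suc k)"
    unfolding context_length_def is_context_def by (intro INF_lower) auto
  then show "context_length g y < \<infinity>"
    by (metis enat_ord_code(4) le_less_trans)
qed

lemma is_context_recent_context_length:
  assumes "context_length g y = enat k"
  shows "is_context g (recent k y)"
proof -
  let ?K = "{k. k \<ge> 1 \<and> is_context g (recent k y)}"
  have eq: "context_length g y = Inf (enat ` ?K)"
    by (simp add: context_length_def is_context_def)
  have "?K \<noteq> {}"
  proof
    assume "?K = {}"
    then have "context_length g y = \<infinity>"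
      unfolding eq by (simp only: image_empty Inf_empty top_enat_def)
    then show False
      using assms by simp
  qed
  then obtain j where "j \<in> ?K"
    by blast
  then have "Inf (enat ` ?K) \<in> enat ` ?K"
    by (intro wellorder_InfI[of "enat j"]) (rule imageI)
  then show ?thesis
    using assms by (auto simp: eq)
qed

text \<open>
  The number of positive lengths at which the past is not yet a context is the context length
  minus 1. Integrated, this is the tail-sum bound for the expectation, with events that depend on
  finitely many coordinates.
\<close>

lemma suminf_not_context_le_context_length:
  "(\<Sum>k. indicator {y. \<not> is_context g (recent (Suc k) y)} y) \<le> ennreal_of_enat (context_length g y)"
proof (cases "context_length g y")
  case (enat n)
  have "indicator {y. \<not> is_context g (recent (Suc k) y)} y = (0 :: ennreal)" if "k \<notin> {..<n}" for k
    using is_context_recent_mono[OF is_context_recent_context_length[OF enat], of "Suc k"] that by simp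
  then have "(\<Sum>k. indicator {y. \<not> is_context g (recent (Suc k) y)} y) =
      (\<Sum>k<n. indicator {y. \<not> is_context g (recent (Suc k) y)} y :: ennreal)"
    by (intro suminf_finite) auto
  also have "\<dots> \<le> (\<Sum>k<n. 1)"
    by (intro sum_mono) (simp add: indicator_def)
  finally show ?thesis
    by (simp add: enat)
qed simp

lemma integrable_context_length_imp_summable:
  fixes M :: "(int \<Rightarrow> 'a::{finite,discrete_topology}) measure"
  assumes M: "sets M = sets borel" "finite_measure M"
    and fin: "(\<integral>\<^sup>+ y. ennreal_of_enat (context_length g (past y)) \<partial>M) < \<infinity>"
  shows "summable (\<lambda>k. measure M {y. \<not> is_context g (recent (Suc k) (past y))})"
proof -
  interpret finite_measure M by fact
  have meas: "{y. \<not> is_context g (recent k (past y))} \<in> sets M" for k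
    unfolding recent_past M(1) by simp
  have "(\<Sum>k. emeasure M {y. \<not> is_context g (recent (Suc k) (past y))}) =
      (\<Sum>k. \<integral>\<^sup>+ y. indicator {y. \<not> is_context g (recent (Suc k) y)} (past y) \<partial>M)"
    by (intro suminf_cong) (simp add: nn_integral_indicator[OF meas, symmetric] indicator_def)
  also have "\<dots> = (\<integral>\<^sup>+ y. (\<Sum>k. indicator {y. \<not> is_context g (recent (Suc k) y)} (past y)) \<partial>M)"
  proof (rule nn_integral_suminf[symmetric])
    fix k
    have "(\<lambda>y. indicator {y. \<not> is_context g (recent (Suc k) y)} (past y)) =
        (indicator {y. \<not> is_context g (recent (Suc k) (past y))} :: _ \<Rightarrow> ennreal)"
      by (auto simp: indicator_def)
    then show "(\<lambda>y. indicator {y. \<not> is_context g (recent (Suc k) y)} (past y) :: ennreal) \<in> borel_measurable M"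
      using meas[of "Suc k"] by simp
  qed
  also have "\<dots> \<le> (\<integral>\<^sup>+ y. ennreal_of_enat (context_length g (past y)) \<partial>M)"
    by (intro nn_integral_mono suminf_not_context_le_context_length)
  also note fin
  finally have "(\<Sum>k. ennreal (measure M {y. \<not> is_context g (recent (Suc k) (past y))})) \<noteq> top"
    by (simp add: emeasure_eq_measure)
  then show ?thesis
    by (rule summable_suminf_not_top[rotated]) simp
qed

section \<open>Weak limits of shift averages\<close>

lemma space_eq_UNIV: "sets M = sets (borel :: 'b::topological_space measure) \<Longrightarrow> space M = UNIV"
  by (drule sets_eq_imp_space_eq) simp

lemma measure_shift_average_cylinder:
  fixes \<mu> :: "(int \<Rightarrow> 'a::discrete_topology) measure"
  assumes "sets \<mu> = sets borel" and "finite_measure \<mu>" and "k \<ge> 1"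
  shows "measure (shift_average \<mu> k) (cylinder m w) =
    (\<Sum>i<k. measure \<mu> (cylinder (m + int i) w)) / real k"
proof -
  interpret finite_measure \<mu> by fact
  have "emeasure (shift_average \<mu> k) (cylinder m w) =
      (\<Sum>i<k. ennreal (measure \<mu> (cylinder (m + int i) w))) / ennreal (real k)"
    by (simp add: emeasure_shift_average[OF assms(1)] shift_power_vimage_cylinder
        emeasure_eq_measure ennreal_of_nat_eq_real_of_nat)
  also have "\<dots> = ennreal ((\<Sum>i<k. measure \<mu> (cylinder (m + int i) w)) / real k)"
    using assms(3) by (simp add: sum_ennreal divide_ennreal sum_nonneg)
  finally show ?thesis
    by (simp add: measure_def sum_nonneg)
qed

lemma tendsto_average_cylinder:
  fixes \<mu> :: "(int \<Rightarrow> 'a::discrete_topology) measure"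
  assumes \<mu>: "sets \<mu> = sets borel" "finite_measure \<mu>"
    and r: "\<And>n. r n \<ge> 1" and lim: "weakly_converges (\<lambda>n. shift_average \<mu> (r n)) \<nu>"
    and \<nu>: "sets \<nu> = sets borel"
  shows "(\<lambda>n. (\<Sum>i<r n. measure \<mu> (cylinder (m + int i) w)) / real (r n))
    \<longlonglongrightarrow> measure \<nu> (cylinder m w)"
proof -
  let ?f = "indicator (cylinder m w) :: (int \<Rightarrow> 'a) \<Rightarrow> real"
  have "bounded (range ?f)"
    by (rule boundedI[of _ 1]) (auto simp: indicator_def)
  then have "(\<lambda>n. \<integral>x. ?f x \<partial>shift_average \<mu> (r n)) \<longlonglongrightarrow> (\<integral>x. ?f x \<partial>\<nu>)"
    using lim continuous_on_indicator_cylinder unfolding weakly_converges_def by blast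
  moreover have "space (shift_average \<mu> k) = UNIV" for k
    by (simp add: shift_average_def space_measure_of_conv)
  ultimately show ?thesis
    using r by (simp add: space_eq_UNIV[OF \<nu>] measure_shift_average_cylinder[OF \<mu>])
qed

lemma tendsto_average_zero:
  fixes e :: "nat \<Rightarrow> real"
  assumes "\<And>k. \<bar>\<Sum>i<k. e i\<bar> \<le> B" and "strict_mono r"
  shows "(\<lambda>n. (\<Sum>i<r n. e i) / real (r n)) \<longlonglongrightarrow> 0"
proof (rule Lim_null_comparison)
  show "\<forall>\<^sub>F n in sequentially. norm ((\<Sum>i<r n. e i) / real (r n)) \<le> B / real (r n)"
    using assms(1) by (simp add: divide_right_mono)
  have "filterlim (\<lambda>n. real (r n)) at_top sequentially"
    by (intro filterlim_compose[OF filterlim_real_sequentially] filterlim_subseq assms(2))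
  then show "(\<lambda>n. B / real (r n)) \<longlonglongrightarrow> 0"
    by (intro tendsto_divide_0[OF tendsto_const] filterlim_at_top_imp_at_infinity)
qed

text \<open>
  Indicators of cylinders are continuous, so weak convergence applies to them. Shifting a cylinder
  by one place changes an average of \<open>k\<close> terms by a telescoping sum, of order
  \<open>1 / k\<close>.
\<close>

lemma weak_limit_stationary:
  fixes \<mu> :: "(int \<Rightarrow> 'a::discrete_topology) measure"
  assumes \<mu>: "sets \<mu> = sets borel" "prob_space \<mu>"
    and lim: "subsequential_weak_limit (shift_average \<mu>) \<nu>"
  shows "measure \<nu> (cylinder m w) = measure \<nu> (cylinder 0 w)"
proof (rule stationary_cylinder)
  fix m
  interpret prob_space \<mu> by fact
  obtain r where \<nu>: "sets \<nu> = sets borel" and r: "strict_mono r" "\<And>n. r n \<ge> 1"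
    and weak: "weakly_converges (\<lambda>n. shift_average \<mu> (r n)) \<nu>"
    using lim unfolding subsequential_weak_limit_def by blast
  let ?f = "\<lambda>i. measure \<mu> (cylinder (m + int i) w)"
  have "\<bar>\<Sum>i<k. ?f (Suc i) - ?f i\<bar> \<le> 1" for k
  proof -
    have "(\<Sum>i<k. ?f (Suc i) - ?f i) = ?f k - ?f 0"
      by (rule sum_lessThan_telescope)
    then show ?thesis
      using prob_le_1 measure_nonneg by (smt (verit))
  qed
  from tendsto_average_zero[OF this r(1)]
  have "(\<lambda>n. (\<Sum>i<r n. ?f (Suc i)) / real (r n) - (\<Sum>i<r n. ?f i) / real (r n)) \<longlonglongrightarrow> 0"
    by (simp add: sum_subtractf diff_divide_distrib)
  moreover have "(\<lambda>n. (\<Sum>i<r n. ?f (Suc i)) / real (r n) - (\<Sum>i<r n. ?f i) / real (r n))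
      \<longlonglongrightarrow> measure \<nu> (cylinder (m + 1) w) - measure \<nu> (cylinder m w)"
    using tendsto_average_cylinder[OF \<mu>(1) finite_measure_axioms r(2) weak \<nu>, of "m + 1" w]
      tendsto_average_cylinder[OF \<mu>(1) finite_measure_axioms r(2) weak \<nu>, of m w]
    by (intro tendsto_diff) (simp_all add: add.assoc)
  ultimately have "measure \<nu> (cylinder (m + 1) w) - measure \<nu> (cylinder m w) = 0"
    by (rule LIMSEQ_unique[symmetric])
  then show "measure \<nu> (cylinder (m + 1) w) = measure \<nu> (cylinder m w)"
    by simp
qed

lemma past_measure_cylinder:
  assumes "past_measure g x \<mu>"
  shows "measure \<mu> (cylinder 0 w) = g_string g x w"
proof (cases "w = []")
  case True
  interpret prob_space \<mu>
    using assms by (simp add: past_measure_def)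
  show ?thesis
    using True prob_space space_eq_UNIV[of \<mu>] assms by (simp add: g_string_def past_measure_def)
qed (use assms in \<open>simp add: past_measure_def\<close>)

text \<open>
  A cylinder at position \<open>i\<close> splits into cylinders at 0 by filling in the
  \<open>i\<close> missing letters. Each of them has a probability given by \<open>g\<close>, and
  the last factor is the same for all because \<open>b\<close> is a context.
\<close>

lemma past_measure_context:
  assumes "past_measure g x \<mu>" and "is_context g b"
  shows "measure \<mu> (cylinder (int i) (b @ [a])) =
    measure \<mu> (cylinder (int i) b) * g (append_string y (b @ [a]))"
proof -
  have \<mu>: "sets \<mu> = sets borel" "prob_space \<mu>"
    using assms(1) by (simp_all add: past_measure_def)
  interpret prob_space \<mu> by fact
  have shift: "measure \<mu> (cylinder (int i) w) = (\<Sum>c\<in>words i. measure \<mu> (cylinder 0 (c @ w)))" for w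
  proof (induction i arbitrary: w)
    case (Suc i)
    have "measure \<mu> (cylinder (int (Suc i)) w) = (\<Sum>a\<in>UNIV. measure \<mu> (cylinder (int i) (a # w)))"
      using sum_measure_cylinder_Cons[OF \<mu>(1) finite_measure_axioms, of "int i" w] by (simp add: add.commute)
    also have "\<dots> = (\<Sum>c\<in>words i. \<Sum>a\<in>UNIV. measure \<mu> (cylinder 0 (c @ a # w)))"
      unfolding Suc.IH by (rule sum.swap)
    also have "\<dots> = (\<Sum>c\<in>words (i + 1). measure \<mu> (cylinder 0 (c @ w)))"
      by (simp only: sum_words_add sum_words_1 append_assoc append_Cons append_Nil)
    finally show ?case
      by simp
  qed simp
  have "measure \<mu> (cylinder 0 (c @ b @ [a])) = measure \<mu> (cylinder 0 (c @ b)) * g (append_string y (b @ [a]))" for c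
    using g_string_snoc[of g x "c @ b" a] is_contextD[OF assms(2), of x c a y]
    by (simp add: past_measure_cylinder[OF assms(1)])
  then show ?thesis
    unfolding shift by (simp add: sum_distrib_right)
qed

text \<open>
  For a context \<open>b\<close> the conditional probability of the next symbol is a relation
  between two cylinders, so it passes to the weak limit although \<open>g\<close> itself may be
  discontinuous.
\<close>

lemma weak_limit_context:
  assumes \<mu>: "past_measure g x \<mu>" and lim: "subsequential_weak_limit (shift_average \<mu>) \<nu>"
    and "is_context g b"
  shows "measure \<nu> (cylinder 0 (b @ [a])) = measure \<nu> (cylinder 0 b) * g (append_string y (b @ [a]))"
proof -
  have borel: "sets \<mu> = sets borel"
    using \<mu> by (simp add: past_measure_def)
  interpret prob_space \<mu>
    using \<mu> by (simp add: past_measure_def)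
  obtain r where \<nu>: "sets \<nu> = sets borel" and r: "\<And>n. r n \<ge> 1"
    and weak: "weakly_converges (\<lambda>n. shift_average \<mu> (r n)) \<nu>"
    using lim unfolding subsequential_weak_limit_def by blast
  note average = tendsto_average_cylinder[OF borel finite_measure_axioms r weak \<nu>, of 0]
  have "(\<lambda>n. (\<Sum>i<r n. measure \<mu> (cylinder (0 + int i) (b @ [a]))) / real (r n))
      \<longlonglongrightarrow> measure \<nu> (cylinder 0 b) * g (append_string y (b @ [a]))"
    using tendsto_mult_right[OF average[of b], of "g (append_string y (b @ [a]))"]
    by (simp add: past_measure_context[OF \<mu> assms(3), where y = y] sum_distrib_right[symmetric])
  with average[of "b @ [a]"] show ?thesis
    by (rule LIMSEQ_unique)
qed

section \<open>Compatibility with a g-function\<close>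

lemma measurable_next_probability:
  assumes "g_function g"
  shows "(\<lambda>y. g (snoc (past y) a)) \<in> borel_measurable (past_algebra :: (int \<Rightarrow> 'a::finite) measure)"
proof -
  have coord: "(\<lambda>y. y i) \<in> measurable (past_algebra :: (int \<Rightarrow> 'a) measure) (count_space UNIV)"
    if "i \<le> - 1" for i
  proof (rule measurableI)
    fix B :: "'a set"
    have "(\<lambda>y. y i) -` B \<in> sigma_sets UNIV {(\<lambda>x. x i) -` B | i B. i \<le> - 1}"
      using that by (intro sigma_sets.Basic) blast
    then show "(\<lambda>y. y i) -` B \<inter> space past_algebra \<in> sets past_algebra"
      by (simp add: past_algebra_def space_measure_of_conv sets_measure_of_conv)
  qed simp
  have "(\<lambda>y. snoc (past y) a) \<in> measurable (past_algebra :: (int \<Rightarrow> 'a) measure) (Pi\<^sub>M UNIV (\<lambda>_. count_space UNIV))"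
  proof (rule measurable_PiM_single')
    fix k :: nat
    show "(\<lambda>y. snoc (past y) a k) \<in> measurable (past_algebra :: (int \<Rightarrow> 'a) measure) (count_space UNIV)"
      by (cases k) (simp_all add: snoc_def past_def coord)
  qed simp
  then show ?thesis
    by (rule measurable_compose[where g = g]) (use assms in \<open>simp add: g_function_def\<close>)
qed

lemma g_function_bounds: "g_function g \<Longrightarrow> 0 \<le> g w" "g_function g \<Longrightarrow> g w \<le> 1"
  by (simp_all add: g_function_def)

lemma mem_past_cylinder_iff: "y \<in> cylinder (- int (length w)) w \<longleftrightarrow> recent (length w) (past y) = w"
  by (simp add: recent_past window_eq_iff)

context
  fixes g :: "(nat \<Rightarrow> 'a::{finite,discrete_topology}) \<Rightarrow> real" and M :: "(int \<Rightarrow> 'a) measure"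
  assumes g: "g_function g" and M: "sets M = sets borel" "prob_space M"
begin

interpretation prob_space M by (fact M)

interpretation past: finite_measure_subalgebra M past_algebra
  by unfold_locales (rule subalgebra_past_algebra[OF M(1)])

lemma next_probability_integrable: "integrable M (\<lambda>y. g (snoc (past y) a))"
proof (rule integrable_const_bound[of _ 1])
  show "(\<lambda>y. g (snoc (past y) a)) \<in> borel_measurable M"
    using measurable_from_subalg[OF past.subalg measurable_next_probability[OF g]] .
qed (simp add: g_function_bounds[OF g])

lemma symbol_integrable: "integrable M (indicator {y. y 0 = a} :: _ \<Rightarrow> real)"
proof (rule integrable_real_indicator)
  show "{y. y 0 = a} \<in> sets M"
    using cylinder_borel[of 0 "[a]"] unfolding M(1) cylinder_single .
  show "emeasure M {y. y 0 = a} < \<infinity>"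
    by (simp add: emeasure_eq_measure)
qed

lemma cylinder_eq_integral_next_probability:
  assumes "AE y in M. real_cond_exp M past_algebra (indicator {y. y 0 = a}) y = g (snoc (past y) a)"
  shows "measure M (cylinder (- int (length w)) (w @ [a])) =
    (\<integral>y\<in>cylinder (- int (length w)) w. g (snoc (past y) a) \<partial>M)"
proof -
  let ?C = "cylinder (- int (length w)) w"
  have "?C \<in> sets past_algebra"
    unfolding past_algebra_eq_sigma_cylinders by (intro sigma_sets.Basic) auto
  then have "(\<integral>y\<in>?C. indicator {y. y 0 = a} y \<partial>M) =
      (\<integral>y\<in>?C. real_cond_exp M past_algebra (indicator {y. y 0 = a}) y \<partial>M)"
    by (rule past.real_cond_exp_intA[OF symbol_integrable])
  also have "\<dots> = (\<integral>y\<in>?C. g (snoc (past y) a) \<partial>M)"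
    by (rule set_lebesgue_integral_cong_AE)
      (use assms measurable_from_subalg[OF past.subalg measurable_next_probability[OF g]] in \<open>auto simp: M(1)\<close>)
  also have "(\<integral>y\<in>?C. indicator {y. y 0 = a} y \<partial>M) = measure M (cylinder (- int (length w)) (w @ [a]))"
    by (simp add: set_lebesgue_integral_def indicator_inter_arith[symmetric] cylinder_snoc space_eq_UNIV[OF M(1)])
  finally show ?thesis
    by simp
qed

text \<open>
  The relation on contexts says that \<open>h = 1 - g\<close> on the event that symbol
  \<open>a\<close> comes next, and \<open>h = - g\<close> off it, integrates to 0 over the
  cylinder of a context. Since almost every past ends in a context, every past cylinder is
  exhausted by such cylinders, and dominated convergence gives integral 0 over all past cylinders;
  they generate the past.
\<close>

lemma cond_exp_eq_next_probability:
  assumes ctx: "\<And>b y. is_context g b \<Longrightarrow> measure M (cylinder (- int (length b)) (b @ [a])) =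
      measure M (cylinder (- int (length b)) b) * g (append_string y (b @ [a]))"
    and finite_context: "measure M {y. \<exists>k. is_context g (recent k (past y))} = 1"
  shows "AE y in M. real_cond_exp M past_algebra (indicator {y. y 0 = a}) y = g (snoc (past y) a)"
proof -
  define h where "h y = indicator {y. y 0 = a} y - g (snoc (past y) a)" for y :: "int \<Rightarrow> 'a"
  have h: "integrable M h"
    unfolding h_def[abs_def] using symbol_integrable next_probability_integrable by (rule Bochner_Integration.integrable_diff)
  then have h_meas [measurable]: "h \<in> borel_measurable M"
    by simp
  have h_bound: "\<bar>h y\<bar> \<le> 1" for y
    using g_function_bounds[OF g, of "snoc (past y) a"] by (auto simp: h_def indicator_def)
  have h_set: "set_integrable M C h" if "C \<in> sets M" for C
    unfolding set_integrable_def using h that by (rule integrable_mult_indicator[rotated])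
  have space: "space M = UNIV"
    by (rule space_eq_UNIV[OF M(1)])
  (* On the cylinder of a context the function g is constant, and its value there can be
     computed from an arbitrary past z. *)
  have context_cyl: "(\<integral>y\<in>cylinder (- int (length b)) b. h y \<partial>M) = 0" if b: "is_context g b" for b
  proof -
    let ?C = "cylinder (- int (length b)) b"
    let ?z = "\<lambda>_. undefined"
    have "indicator ?C y * h y = indicator (cylinder (- int (length b)) (b @ [a])) y
        - indicator ?C y * g (append_string ?z (b @ [a]))" for y
      using g_at_context[of g "length b" "past y" a ?z] b
      by (auto simp: h_def cylinder_snoc indicator_def mem_past_cylinder_iff)
    then have "(\<integral>y\<in>?C. h y \<partial>M) = measure M (cylinder (- int (length b)) (b @ [a]))
        - measure M ?C * g (append_string ?z (b @ [a]))"
      by (simp add: set_lebesgue_integral_def space M(1) emeasure_eq_measure)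
    then show ?thesis
      using ctx[OF b, of ?z] by simp
  qed
  have cyl: "(\<integral>y\<in>cylinder (- int (length w)) w. h y \<partial>M) = 0" for w
  proof -
    let ?C = "cylinder (- int (length w)) w"
    define D where "D k = {y. is_context g (recent k (past y))}" for k
    have D_meas [measurable]: "D k \<in> sets M" for k
      unfolding D_def recent_past M(1) by simp
    (* The part of the cylinder where the last length w + k symbols form a context is a disjoint
       union of cylinders of contexts. *)
    have zero: "(\<integral>y\<in>?C \<inter> D (length w + k). h y \<partial>M) = 0" for k
    proof -
      let ?n = "length w + k"
      let ?S = "{v \<in> words ?n. drop k v = w \<and> is_context g v}"
      have "?C \<inter> D ?n = {y. drop k (window (- int ?n) ?n y) = w \<and> is_context g (window (- int ?n) ?n y)}"
      proof -
        have drop: "drop k (recent ?n (past y)) = recent (length w) (past y)" for y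
          by (simp add: recent_add) (simp add: recent_def)
        show ?thesis
          by (intro set_eqI) (simp only: drop Int_iff mem_Collect_eq D_def mem_past_cylinder_iff recent_past[symmetric])
      qed
      also have "\<dots> = (\<Union>v\<in>?S. cylinder (- int ?n) v)"
        by (rule window_event_eq)
      finally have "(\<integral>y\<in>?C \<inter> D ?n. h y \<partial>M) = (\<integral>y\<in>(\<Union>v\<in>?S. cylinder (- int ?n) v). h y \<partial>M)"
        by simp
      also have "\<dots> = (\<Sum>v\<in>?S. \<integral>y\<in>cylinder (- int ?n) v. h y \<partial>M)"
        by (rule set_integral_finite_Union)
          (auto intro!: disjoint_family_cylinders[of _ ?n] h_set simp: M(1))
      also have "\<dots> = (\<Sum>v\<in>?S. 0)"
        by (rule sum.cong[OF refl]) (use context_cyl in auto)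
      finally show ?thesis
        by simp
    qed
    have "(\<lambda>k. \<integral>y. indicator (?C \<inter> D (length w + k)) y *\<^sub>R h y \<partial>M) \<longlonglongrightarrow> (\<integral>y. indicator ?C y *\<^sub>R h y \<partial>M)"
    proof (rule integral_dominated_convergence[where w = "\<lambda>_. 1"])
      have "AE y in M. y \<in> (\<Union>k. D k)"
      proof (rule AE_in_set_eq_1[THEN iffD2])
        have "(\<Union>k. D k) = {y. \<exists>k. is_context g (recent k (past y))}"
          by (auto simp: D_def)
        then show "prob (\<Union>k. D k) = 1"
          using finite_context by simp
      qed measurable
      then show "AE y in M. (\<lambda>k. indicator (?C \<inter> D (length w + k)) y *\<^sub>R h y) \<longlonglongrightarrow> indicator ?C y *\<^sub>R h y"
      proof eventually_elim
        case (elim y)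
        then obtain k where k: "y \<in> D k"
          by blast
        have "y \<in> D (length w + j)" if "j \<ge> k" for j
          using is_context_recent_mono[of g k "past y" "length w + j"] k that by (simp add: D_def)
        then have "\<forall>\<^sub>F j in sequentially. indicator ?C y *\<^sub>R h y = indicator (?C \<inter> D (length w + j)) y *\<^sub>R h y"
          by (intro eventually_sequentiallyI[of k]) (simp add: indicator_def)
        then show ?case
          by (rule Lim_transform_eventually[OF tendsto_const])
      qed
      show "AE y in M. norm (indicator (?C \<inter> D (length w + k)) y *\<^sub>R h y) \<le> 1" for k
        using h_bound by (auto simp: indicator_def)
      show "(\<lambda>y. indicator ?C y *\<^sub>R h y) \<in> borel_measurable M"
        by (rule borel_measurable_integrable[OF h_set[unfolded set_integrable_def]]) (simp add: M(1))
      show "(\<lambda>y. indicator (?C \<inter> D (length w + k)) y *\<^sub>R h y) \<in> borel_measurable M" for k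
        by (rule borel_measurable_integrable[OF h_set[unfolded set_integrable_def]],
            rule sets.Int[OF _ D_meas]) (simp add: M(1))
    qed simp
    then show ?thesis
      using zero by (simp add: set_lebesgue_integral_def LIMSEQ_const_iff)
  qed
  have sub: "C \<in> sets M" if "C \<in> sets past_algebra" for C
    using that past.subalg by (auto simp: subalgebra_def)
  have null: "(\<integral>y\<in>C. h y \<partial>M) = 0" if "C \<in> sets past_algebra" for C
  proof -
    have Pow: "insert {} {cylinder (- int n) w | n w. length w = n} \<subseteq> Pow (UNIV :: (int \<Rightarrow> 'a) set)"
      by simp
    show ?thesis
      using that unfolding past_algebra_eq_sigma_cylinders
    proof (induction rule: sigma_sets_induct_disjoint[OF Int_stable_past_cylinders Pow,
          consumes 1, case_names basic empty compl union])
      case (basic C)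
      then show ?case
        using cyl by (auto simp: set_lebesgue_integral_def)
    next
      case empty
      show ?case
        by (simp add: set_lebesgue_integral_def)
    next
      case (compl C)
      then have C: "C \<in> sets M"
        by (intro sub) (simp add: past_algebra_eq_sigma_cylinders)
      have "(\<integral>y\<in>C \<union> (UNIV - C). h y \<partial>M) = (\<integral>y\<in>C. h y \<partial>M) + (\<integral>y\<in>UNIV - C. h y \<partial>M)"
        by (rule set_integral_Un) (use C space sets.compl_sets[OF C] in \<open>auto intro: h_set\<close>)
      then show ?case
        using cyl[of "[]"] compl(2) by simp
    next
      case (union A)
      then have "A i \<in> sets M" for i
        by (intro sub) (auto simp: past_algebra_eq_sigma_cylinders)
      then show ?case
        using union by (subst lebesgue_integral_countable_add) (auto simp: disjoint_family_on_def intro!: h_set)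
    qed
  qed
  have "(\<integral>y\<in>C. indicator {y. y 0 = a} y \<partial>M) = (\<integral>y\<in>C. g (snoc (past y) a) \<partial>M)"
    if "C \<in> sets past_algebra" for C
  proof -
    have "(\<integral>y\<in>C. indicator {y. y 0 = a} y - g (snoc (past y) a) \<partial>M) = 0" and C: "C \<in> sets M"
      using null[OF that] sub[OF that] unfolding h_def by auto
    then show ?thesis
      using integrable_mult_indicator[OF C symbol_integrable, of a]
        integrable_mult_indicator[OF C next_probability_integrable, of a]
      by (subst (asm) set_integral_diff) (simp_all add: set_integrable_def)
  qed
  then show ?thesis
    by (rule past.real_cond_exp_charact[OF _ symbol_integrable next_probability_integrable
          measurable_next_probability[OF g]])
qed

end

section \<open>Weights of compatible measures\<close>

lemma
  assumes "\<rho> \<in> invariant_g_measures g"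
  shows invariant_g_measure_prob: "sets \<rho> = sets borel" "prob_space \<rho>"
    and invariant_g_measure_stationary: "measure \<rho> (cylinder m w) = measure \<rho> (cylinder 0 w)"
    and invariant_g_measure_weights: "stationary_weights (\<lambda>w. measure \<rho> (cylinder 0 w))"
proof -
  show \<rho>: "sets \<rho> = sets borel" "prob_space \<rho>"
    using assms by (simp_all add: invariant_g_measures_def)
  have "distr \<rho> \<rho> shift = \<rho>"
    using assms by (simp add: invariant_g_measures_def)
  then show stat: "measure \<rho> (cylinder m w) = measure \<rho> (cylinder 0 w)" for m w
    by (intro stationary_cylinder) (metis measure_distr_shift_cylinder[OF \<rho>(1)])
  show "stationary_weights (\<lambda>w. measure \<rho> (cylinder 0 w))"
    by (rule stationary_weights_measure_cylinder[OF \<rho> stat])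
qed

lemma invariant_g_measure_snoc:
  assumes "g_function g" and "\<rho> \<in> invariant_g_measures g"
  shows "measure \<rho> (cylinder 0 (w @ [a])) =
    (\<integral>y\<in>cylinder (- int (length w)) w. g (snoc (past y) a) \<partial>\<rho>)"
proof -
  have "AE y in \<rho>. real_cond_exp \<rho> past_algebra (indicator {y. y 0 = a}) y = g (snoc (past y) a)"
    using assms(2) by (simp add: invariant_g_measures_def)
  from cylinder_eq_integral_next_probability[OF assms(1) invariant_g_measure_prob[OF assms(2)] this, of w]
  show ?thesis
    unfolding invariant_g_measure_stationary[OF assms(2), of "- int (length w)" "w @ [a]"] .
qed

lemma invariant_g_measure_lower_bound:
  assumes g: "g_function g" and \<rho>: "\<rho> \<in> invariant_g_measures g" and \<epsilon>: "\<And>w. \<epsilon> \<le> g w"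
  shows "\<epsilon> * measure \<rho> (cylinder 0 w) \<le> measure \<rho> (cylinder 0 (w @ [a]))"
proof -
  note prob = invariant_g_measure_prob[OF \<rho>]
  interpret prob_space \<rho> by (rule prob)
  let ?C = "cylinder (- int (length w)) w"
  have C: "?C \<in> sets \<rho>"
    by (simp add: prob(1))
  have "(\<integral>y\<in>?C. \<epsilon> \<partial>\<rho>) \<le> (\<integral>y\<in>?C. g (snoc (past y) a) \<partial>\<rho>)"
  proof (rule set_integral_mono)
    show "set_integrable \<rho> ?C (\<lambda>y. g (snoc (past y) a))"
      unfolding set_integrable_def
      by (rule integrable_mult_indicator[OF C next_probability_integrable[OF g prob]])
    show "set_integrable \<rho> ?C (\<lambda>y. \<epsilon>)"
      unfolding set_integrable_def by (rule integrable_mult_indicator[OF C]) simp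
  qed (rule \<epsilon>)
  then have "\<epsilon> * measure \<rho> ?C \<le> measure \<rho> (cylinder 0 (w @ [a]))"
    using C by (simp add: invariant_g_measure_snoc[OF g \<rho>] set_integral_const emeasure_eq_measure mult.commute)
  then show ?thesis
    unfolding invariant_g_measure_stationary[OF \<rho>, of "- int (length w)" w] .
qed

text \<open>
  On the cylinder of \<open>u @ b\<close> all pasts give the next symbol the same probability, so
  the integral of \<open>invariant_g_measure_snoc\<close> factorises, with a factor that depends
  neither on \<open>u\<close> nor on \<open>\<rho>\<close>.
\<close>

lemma invariant_g_measure_context:
  assumes g: "g_function g" and \<rho>: "\<rho> \<in> invariant_g_measures g" and b: "is_context g b"
  shows "measure \<rho> (cylinder 0 (u @ b @ [a])) =
    measure \<rho> (cylinder 0 (u @ b)) * g (append_string z (b @ [a]))"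
proof -
  note prob = invariant_g_measure_prob[OF \<rho>]
  interpret prob_space \<rho> by (rule prob)
  let ?C = "cylinder (- int (length (u @ b))) (u @ b)"
  have C: "?C \<in> sets \<rho>"
    by (simp add: prob(1))
  have "g (snoc (past y) a) = g (append_string z (b @ [a]))" if "y \<in> ?C" for y
  proof -
    have "recent (length (u @ b)) (past y) = u @ b"
      using that by (simp only: mem_past_cylinder_iff)
    then show ?thesis
      using g_at_context[of g "length (u @ b)" "past y" a z] is_context_append[OF b, of u]
        is_contextD[OF b, of z u a z] by simp
  qed
  then have "(\<integral>y\<in>?C. g (snoc (past y) a) \<partial>\<rho>) = (\<integral>y\<in>?C. g (append_string z (b @ [a])) \<partial>\<rho>)"
    by (intro set_lebesgue_integral_cong) (use C in auto)
  moreover have "\<dots> = measure \<rho> ?C * g (append_string z (b @ [a]))"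
    using C by (simp add: set_integral_const emeasure_eq_measure)
  ultimately show ?thesis
    using invariant_g_measure_snoc[OF g \<rho>, of "u @ b" a]
      invariant_g_measure_stationary[OF \<rho>, of "- int (length (u @ b))" "u @ b"] by simp
qed

section \<open>Renewal words\<close>

text \<open>
  The continuations of \<open>b\<close> along which every letter is drawn with a context that
  reaches back no further than the beginning of \<open>b\<close>. Along them the past before
  \<open>b\<close> is forgotten.
\<close>

definition renewal_continuations :: "((nat \<Rightarrow> 'a) \<Rightarrow> real) \<Rightarrow> 'a list \<Rightarrow> nat \<Rightarrow> 'a list set" where
  "renewal_continuations g b n = {v\<in>words n. \<forall>k<n. is_context g (b @ take k v)}"

lemma finite_renewal_continuations [simp]:
  "finite (renewal_continuations g (b :: 'a::finite list) n)"
  by (rule finite_subset[OF _ finite_words[of n]]) (auto simp: renewal_continuations_def)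

lemma renewal_continuations_snoc:
  "v @ [a] \<in> renewal_continuations g b (Suc n) \<longleftrightarrow>
    v \<in> renewal_continuations g b n \<and> is_context g (b @ v)"
  by (auto simp: renewal_continuations_def less_Suc_eq)

lemma weight_renewal_continuation:
  fixes p :: "'a::finite list \<Rightarrow> real"
  assumes "\<And>u b a. is_context g b \<Longrightarrow> p (u @ b @ [a]) = p (u @ b) * g (append_string z (b @ [a]))"
    and "v \<in> renewal_continuations g b n"
  shows "p (u @ b @ v) = p (u @ b) * g_string g (append_string z b) v"
  using assms(2)
proof (induction v arbitrary: n rule: rev_induct)
  case Nil
  then show ?case
    by (simp add: g_string_def)
next
  case (snoc a v)
  obtain m where "n = Suc m"
    using snoc.prems by (cases n) (auto simp: renewal_continuations_def)
  then have v: "v \<in> renewal_continuations g b m" "is_context g (b @ v)"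
    using snoc.prems by (simp_all add: renewal_continuations_snoc)
  have "p (u @ b @ v @ [a]) = p (u @ b @ v) * g (append_string z ((b @ v) @ [a]))"
    using assms(1)[OF v(2), of u a] by simp
  also have "\<dots> = p (u @ b) * g_string g (append_string z b) (v @ [a])"
    using snoc.IH[OF v(1)] by (simp add: g_string_snoc append_string_append)
  finally show ?case
    by simp
qed

text \<open>
  A continuation of length \<open>Suc n\<close> extends one of length \<open>n\<close> by a
  letter, and \<open>g\<close> sums to 1 over the letters.
\<close>

lemma decseq_renewal_probability:
  fixes g :: "(nat \<Rightarrow> 'a::finite) \<Rightarrow> real"
  assumes g: "g_function g"
  shows "decseq (\<lambda>n. \<Sum>v\<in>renewal_continuations g b n. g_string g y v)"
proof (rule decseq_SucI)
  fix n
  let ?V = "renewal_continuations g b"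
  have "(\<Sum>v\<in>?V (Suc n). g_string g y v) \<le> (\<Sum>v\<in>(\<lambda>(v, a). v @ [a]) ` (?V n \<times> UNIV). g_string g y v)"
  proof (rule sum_mono2)
    show "?V (Suc n) \<subseteq> (\<lambda>(v, a). v @ [a]) ` (?V n \<times> UNIV)"
    proof
      fix w assume w: "w \<in> ?V (Suc n)"
      then obtain v a where "w = v @ [a]"
        by (cases w rule: rev_cases) (auto simp: renewal_continuations_def)
      then show "w \<in> (\<lambda>(v, a). v @ [a]) ` (?V n \<times> UNIV)"
        using w by (auto simp: renewal_continuations_snoc image_iff)
    qed
  qed (simp_all add: g_string_nonneg[OF g])
  also have "\<dots> = (\<Sum>(v, a)\<in>?V n \<times> UNIV. g_string g y (v @ [a]))"
    by (subst sum.reindex) (auto simp: inj_on_def intro: sum.cong)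
  also have "\<dots> = (\<Sum>v\<in>?V n. \<Sum>a\<in>UNIV. g_string g y (v @ [a]))"
    by (rule sum.cartesian_product[symmetric])
  also have "\<dots> = (\<Sum>v\<in>?V n. g_string g y v)"
    using g by (simp add: g_string_snoc append_string_snoc sum_distrib_left[symmetric] g_function_def)
  finally show "(\<Sum>v\<in>?V (Suc n). g_string g y v) \<le> (\<Sum>v\<in>?V n. g_string g y v)" .
qed

lemma sum_words_prefix_event:
  fixes p :: "'a::finite list \<Rightarrow> real"
  assumes "stationary_weights p" and "j \<le> n"
  shows "(\<Sum>w\<in>words n. of_bool (P (take j w)) * p w) = (\<Sum>u\<in>words j. of_bool (P u) * p u)"
proof -
  have "(\<Sum>w\<in>words (j + (n - j)). of_bool (P (take j w)) * p w) =
      (\<Sum>u\<in>words j. \<Sum>v\<in>words (n - j). of_bool (P u) * p (u @ v))"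
    unfolding sum_words_add by (intro sum.cong) auto
  also have "\<dots> = (\<Sum>u\<in>words j. of_bool (P u) * p u)"
    using assms(1) by (simp add: sum_distrib_left[symmetric] sum_right_extensions stationary_weights_def)
  finally show ?thesis
    using assms(2) by simp
qed

text \<open>
  A Borel-Cantelli argument: if the probabilities that the first \<open>k\<close>
  letters are not a context are summable, then from some length \<open>Suc N\<close> on they add up
  to \<open>S < 1\<close>. So with probability at least \<open>1 - S\<close> every letter after
  the first \<open>Suc N\<close> follows a word that is a context, whatever the total length. This
  mass is shared by finitely many initial words \<open>b\<close> of length \<open>Suc N\<close>,
  and for each of them it decreases with the length of the continuation, so for at least one
  \<open>b\<close> it does not tend to 0.
\<close>

lemma exists_renewal_word:
  fixes g :: "(nat \<Rightarrow> 'a::finite) \<Rightarrow> real" and p :: "'a list \<Rightarrow> real"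
  assumes g: "g_function g" and p: "stationary_weights p"
    and ctx: "\<And>u b a. is_context g b \<Longrightarrow> p (u @ b @ [a]) = p (u @ b) * g (append_string z (b @ [a]))"
    and sum: "summable (\<lambda>k. \<Sum>w\<in>words (Suc k). of_bool (\<not> is_context g w) * p w)"
  shows "\<exists>b \<delta>. 0 < \<delta> \<and> (\<forall>n. \<delta> \<le> (\<Sum>v\<in>renewal_continuations g b n. g_string g (append_string z b) v))"
proof -
  have nonneg: "0 \<le> p w" for w
    using p by (simp add: stationary_weights_def)
  define bad where "bad k = (\<Sum>w\<in>words k. of_bool (\<not> is_context g w) * p w)" for k
  have bad_nonneg: "0 \<le> bad k" for k
    unfolding bad_def by (intro sum_nonneg) (simp add: nonneg)
  have summable: "summable (\<lambda>k. bad (Suc k))"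
    using sum by (simp add: bad_def)
  obtain N where "\<bar>\<Sum>i. bad (Suc (i + N))\<bar> < 1"
    using suminf_exist_split[OF zero_less_one summable] by auto
  then have tail: "(\<Sum>i. bad (Suc (i + N))) < 1"
    by simp
  define S where "S = (\<Sum>i. bad (Suc N + i))"
  have S: "S < 1"
    using tail by (simp add: S_def add.commute)
  have "summable (\<lambda>i. bad (Suc N + i))"
    using summable_ignore_initial_segment[OF summable, of N] by (simp add: add.commute)
  then have partial: "(\<Sum>k<n. bad (Suc N + k)) \<le> S" for n
    unfolding S_def by (intro sum_le_suminf) (simp_all add: bad_nonneg)
  define Q where "Q b n = (\<Sum>v\<in>renewal_continuations g b n. g_string g (append_string z b) v)" for b n
  have mass: "1 - S \<le> (\<Sum>b\<in>words (Suc N). p b * Q b n)" for n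
  proof -
    let ?good = "\<lambda>w. \<forall>k<n. is_context g (take (Suc N + k) w)"
    (* Union bound over the positions at which the word read so far is not a context. *)
    have "1 = (\<Sum>w\<in>words (Suc N + n). p w)"
      using sum_right_extensions[of p, where n = "Suc N + n" and w = "[]"] p
      by (simp add: stationary_weights_def)
    also have "\<dots> \<le> (\<Sum>w\<in>words (Suc N + n). of_bool (?good w) * p w +
        (\<Sum>k<n. of_bool (\<not> is_context g (take (Suc N + k) w)) * p w))"
    proof (rule sum_mono)
      fix w
      show "p w \<le> of_bool (?good w) * p w + (\<Sum>k<n. of_bool (\<not> is_context g (take (Suc N + k) w)) * p w)"
      proof (cases "?good w")
        case False
        then obtain j where j: "j < n" "\<not> is_context g (take (Suc N + j) w)"
          by blast
        then have "p w = of_bool (\<not> is_context g (take (Suc N + j) w)) * p w"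
          by simp
        also have "\<dots> \<le> (\<Sum>k<n. of_bool (\<not> is_context g (take (Suc N + k) w)) * p w)"
          using j(1) by (intro member_le_sum) (auto simp: nonneg)
        finally show ?thesis
          by (rule add_increasing[rotated]) (simp add: nonneg)
      qed (simp add: nonneg sum_nonneg)
    qed
    also have "\<dots> = (\<Sum>w\<in>words (Suc N + n). of_bool (?good w) * p w) + (\<Sum>k<n. bad (Suc N + k))"
    proof -
      have "(\<Sum>w\<in>words (Suc N + n). \<Sum>k<n. of_bool (\<not> is_context g (take (Suc N + k) w)) * p w) =
          (\<Sum>k<n. \<Sum>w\<in>words (Suc N + n). of_bool (\<not> is_context g (take (Suc N + k) w)) * p w)"
        by (rule sum.swap)
      also have "\<dots> = (\<Sum>k<n. bad (Suc N + k))"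
        unfolding bad_def by (intro sum.cong refl sum_words_prefix_event[OF p]) simp
      finally show ?thesis
        by (simp only: sum.distrib)
    qed
    also have "(\<Sum>w\<in>words (Suc N + n). of_bool (?good w) * p w) = (\<Sum>b\<in>words (Suc N). p b * Q b n)"
      unfolding sum_words_add
    proof (rule sum.cong[OF refl])
      fix b :: "'a list"
      assume "b \<in> words (Suc N)"
      then have "(\<Sum>v\<in>words n. of_bool (?good (b @ v)) * p (b @ v)) =
          (\<Sum>v\<in>words n. if v \<in> renewal_continuations g b n then p (b @ v) else 0)"
        by (intro sum.cong) (auto simp: renewal_continuations_def)
      also have "\<dots> = (\<Sum>v\<in>renewal_continuations g b n. p (b @ v))"
        by (subst sum.inter_restrict[symmetric])
          (auto simp: renewal_continuations_def intro!: sum.cong)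
      also have "\<dots> = p b * Q b n"
        using weight_renewal_continuation[OF ctx, of _ b n "[]"] by (simp add: Q_def sum_distrib_left)
      finally show "(\<Sum>v\<in>words n. of_bool (?good (b @ v)) * p (b @ v)) = p b * Q b n" .
    qed
    finally show ?thesis
      using partial[of n] by linarith
  qed
  have "\<exists>l. Q b \<longlonglongrightarrow> l \<and> (\<forall>n. l \<le> Q b n)" for b
  proof -
    have "decseq (Q b)"
      unfolding Q_def[abs_def] by (rule decseq_renewal_probability[OF g])
    moreover have "0 \<le> Q b n" for n
      unfolding Q_def by (intro sum_nonneg g_string_nonneg[OF g])
    ultimately show ?thesis
      by (metis decseq_convergent)
  qed
  then obtain l where l: "\<And>b. Q b \<longlonglongrightarrow> l b" "\<And>b n. l b \<le> Q b n"
    by metis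
  have "(\<lambda>n. \<Sum>b\<in>words (Suc N). p b * Q b n) \<longlonglongrightarrow> (\<Sum>b\<in>words (Suc N). p b * l b)"
    by (intro tendsto_sum tendsto_mult tendsto_const l(1))
  then have "1 - S \<le> (\<Sum>b\<in>words (Suc N). p b * l b)"
    by (rule LIMSEQ_le_const) (use mass in auto)
  then have "0 < (\<Sum>b\<in>words (Suc N). p b * l b)"
    using S by linarith
  then obtain b where "0 < p b * l b"
    by (meson not_less sum_nonpos)
  then have "0 < l b"
    using nonneg[of b] by (simp add: zero_less_mult_iff)
  then show ?thesis
    using l(2)[of b] unfolding Q_def by blast
qed

section \<open>The limit measure and uniqueness\<close>

theorem theorem2:
  fixes g :: "(nat \<Rightarrow> 'a::{finite,discrete_topology}) \<Rightarrow> real"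
    and x :: "nat \<Rightarrow> 'a"
    and \<mu> \<nu> :: "(int \<Rightarrow> 'a) measure"
  assumes "g_function g"
    and "past_measure g x \<mu>"
    and "subsequential_weak_limit (shift_average \<mu>) \<nu>"
  shows "(measure \<nu> {y. context_length g (past y) < \<infinity>} = 1 \<longrightarrow> \<nu> \<in> invariant_g_measures g) \<and>
         ((\<integral>\<^sup>+ y. ennreal_of_enat (context_length g (past y)) \<partial>\<nu>) < \<infinity> \<and> (INF w. g w) > 0 \<longrightarrow>
            (\<exists>!\<rho>. \<rho> \<in> invariant_g_measures g))"
proof -
  note g = assms(1)
  have \<nu>: "sets \<nu> = sets borel" "prob_space \<nu>"
    using assms(3) by (simp_all add: subsequential_weak_limit_def)
  interpret prob_space \<nu> by (rule \<nu>)
  have \<mu>: "sets \<mu> = sets borel" "prob_space \<mu>"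
    using assms(2) by (simp_all add: past_measure_def)
  note stationary = weak_limit_stationary[OF \<mu> assms(3)]
  have member: "\<nu> \<in> invariant_g_measures g"
    if "measure \<nu> {y. \<exists>k. is_context g (recent k (past y))} = 1"
  proof -
    have "distr \<nu> \<nu> shift = \<nu>"
    proof (rule measure_eqI_cylinders)
      have "shift \<in> measurable \<nu> \<nu>"
        using measurable_shift by (simp add: measurable_cong_sets[OF \<nu>(1) \<nu>(1)])
      then show "finite_measure (distr \<nu> \<nu> shift)"
        by (rule finite_measure_distr)
      show "measure (distr \<nu> \<nu> shift) (cylinder m w) = measure \<nu> (cylinder m w)" for m w
        unfolding measure_distr_shift_cylinder[OF \<nu>(1)] stationary[of "m + 1" w]
        by (rule stationary[symmetric])
    qed (simp_all add: \<nu>(1) finite_measure_axioms)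
    moreover have "AE y in \<nu>. real_cond_exp \<nu> past_algebra (indicator {y. y 0 = a}) y = g (snoc (past y) a)" for a
    proof (rule cond_exp_eq_next_probability[OF g \<nu> _ that])
      fix b y
      assume "is_context g b"
      then show "measure \<nu> (cylinder (- int (length b)) (b @ [a])) =
          measure \<nu> (cylinder (- int (length b)) b) * g (append_string y (b @ [a]))"
        unfolding stationary[of "- int (length b)"] by (rule weak_limit_context[OF assms(2,3)])
    qed
    ultimately show ?thesis
      using \<nu> by (simp add: invariant_g_measures_def)
  qed
  have unique: "\<exists>!\<rho>. \<rho> \<in> invariant_g_measures g"
    if fin: "(\<integral>\<^sup>+ y. ennreal_of_enat (context_length g (past y)) \<partial>\<nu>) < \<infinity>" and pos: "(INF w. g w) > 0"
  proof -
    let ?bad = "\<lambda>k. {y. \<not> is_context g (recent k (past y))}"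
    have meas: "?bad k \<in> sets \<nu>" for k
      unfolding recent_past \<nu>(1) by simp
    have summable: "summable (\<lambda>k. measure \<nu> (?bad (Suc k)))"
      by (rule integrable_context_length_imp_summable[OF \<nu>(1) finite_measure_axioms fin])
    (* Summable probabilities tend to 0, so almost surely some recent word is a context. *)
    have "measure \<nu> {y. \<exists>k. is_context g (recent k (past y))} = 1"
    proof -
      let ?never = "\<Inter>k. ?bad k"
      have never: "?never \<in> sets \<nu>"
        using meas by (intro sets.countable_INT) auto
      have "measure \<nu> ?never \<le> measure \<nu> (?bad (Suc k))" for k
        by (intro finite_measure_mono meas) auto
      then have "measure \<nu> ?never \<le> 0"
        by (intro LIMSEQ_le_const[OF summable_LIMSEQ_zero[OF summable]]) auto
      then have "measure \<nu> (space \<nu> - ?never) = 1"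
        using prob_compl[OF never] measure_nonneg[of \<nu> ?never] by linarith
      moreover have "space \<nu> - ?never = {y. \<exists>k. is_context g (recent k (past y))}"
        by (auto simp: space_eq_UNIV[OF \<nu>(1)])
      ultimately show ?thesis
        by simp
    qed
    then have \<nu>_member: "\<nu> \<in> invariant_g_measures g"
      by (rule member)
    define \<epsilon> where "\<epsilon> = (INF w. g w)"
    have \<epsilon>: "\<epsilon> \<le> g w" for w
      unfolding \<epsilon>_def using g_function_bounds(1)[OF g] by (intro cINF_lower bdd_belowI2) auto
    have \<epsilon>_le: "0 < \<epsilon>" "\<epsilon> \<le> 1"
      using pos \<epsilon>[of undefined] g_function_bounds(2)[OF g, of undefined] by (auto simp: \<epsilon>_def)
    define z where "z = (\<lambda>_ :: nat. undefined :: 'a)"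
    have ctx: "measure \<rho> (cylinder 0 (u @ b @ [a])) =
        measure \<rho> (cylinder 0 (u @ b)) * g (append_string z (b @ [a]))"
      if "\<rho> \<in> invariant_g_measures g" "is_context g b" for \<rho> u b a
      by (rule invariant_g_measure_context[OF g that])
    have "measure \<nu> (?bad (Suc k)) =
        (\<Sum>w\<in>words (Suc k). of_bool (\<not> is_context g w) * measure \<nu> (cylinder 0 w))" for k
    proof -
      have "measure \<nu> (?bad (Suc k)) = (\<Sum>w | w \<in> words (Suc k) \<and> \<not> is_context g w.
          measure \<nu> (cylinder (- int (Suc k)) w))"
        unfolding recent_past by (rule measure_window_event[OF \<nu>(1) finite_measure_axioms])
      also have "\<dots> = (\<Sum>w | w \<in> words (Suc k) \<and> \<not> is_context g w. measure \<nu> (cylinder 0 w))"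
        by (rule sum.cong[OF refl stationary])
      also have "\<dots> = (\<Sum>w\<in>words (Suc k). of_bool (\<not> is_context g w) * measure \<nu> (cylinder 0 w))"
        by (intro sum.mono_neutral_cong_left) auto
      finally show ?thesis .
    qed
    then have "summable (\<lambda>k. \<Sum>w\<in>words (Suc k). of_bool (\<not> is_context g w) * measure \<nu> (cylinder 0 w))"
      using summable by simp
    from exists_renewal_word[OF g invariant_g_measure_weights[OF \<nu>_member] ctx[OF \<nu>_member] this]
    obtain b \<delta> where \<delta>: "0 < \<delta>"
      "\<And>n. \<delta> \<le> (\<Sum>v\<in>renewal_continuations g b n. g_string g (append_string z b) v)"
      by blast
    have "\<rho> = \<nu>" if \<rho>: "\<rho> \<in> invariant_g_measures g" for \<rho>
    proof -
      have "(\<lambda>w. measure \<rho> (cylinder 0 w)) = (\<lambda>w. measure \<nu> (cylinder 0 w))"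
      proof (rule stationary_weights_unique[OF invariant_g_measure_weights[OF \<rho>]
            invariant_g_measure_weights[OF \<nu>_member] \<epsilon>_le])
        show "renewal_continuations g b n \<subseteq> words n" for n
          by (auto simp: renewal_continuations_def)
      qed (rule \<delta> g_string_nonneg[OF g] invariant_g_measure_lower_bound[OF g \<rho> \<epsilon>]
          invariant_g_measure_lower_bound[OF g \<nu>_member \<epsilon>]
          weight_renewal_continuation[OF ctx[OF \<rho>]] weight_renewal_continuation[OF ctx[OF \<nu>_member]] | assumption)+
      then have "measure \<rho> (cylinder m w) = measure \<nu> (cylinder m w)" for m w
        unfolding stationary[of m w] invariant_g_measure_stationary[OF \<rho>, of m w] by (rule fun_cong)
      then show ?thesis
        using invariant_g_measure_prob[OF \<rho>]
        by (intro measure_eqI_cylinders)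
          (simp_all add: \<nu>(1) finite_measure_axioms prob_space.finite_measure)
    qed
    then show ?thesis
      using \<nu>_member by blast
  qed
  show ?thesis
    using member unique unfolding context_length_finite_iff by blast
qed

end
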